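(* Let $n\ge1$, $0<p<1$, $\nu\in\mathbb{R}$, $\sigma\in J_n^+$, and let $V(x,t)=\zeta(t)(1+t)^\nu|x|^\sigma$ where $\zeta>0$ is continuous with $\lim_{t\to\infty}t^\delta\zeta(t)=\infty$ and $\lim_{t\to\infty}t^{-\delta}\zeta(t)=0$ for every $\delta>0$, and, in case $\sigma>0$, $\zeta(t)(1+t)^\nu\in\mathcal{E}_\varepsilon$ for some $\varepsilon\in(0,1)$. Set $a_0=\frac{\sigma}{1-p}$ and $a_c=\frac{\sigma+2(\nu+1)_+}{1-p}$. Let $u_0\ge0$ be continuous with $$\liminf_{|x|\to\infty}|x|^{-a}u_0(x)=l_1,\qquad\limsup_{|x|\to\infty}|x|^{-a}u_0(x)=l_2,\qquad l_1,l_2\in(0,\infty),$$ where $a\in(a_c,\infty)$. Let $u$ be the global s-solution of $\partial_tu-\Delta\partial_tu=\Delta u+Vu^p$, $u(\cdot,0)=u_0$, and fix $R>0$. Then there are constants $\underline C,\overline C>0$ such that $$\underline C\,l_1\,t^{a/2}\le\|u(\cdot,t)\|_{R,a}\le\overline C\,l_2\,t^{a/2}\quad\text{for all sufficiently large }t.$$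
   Context: $J_n^+=\{0\}\cup[1,\infty)$ if $n=1$, $[0,\infty)$ if $n\ge2$; $s_+=\max\{s,0\}$. $\|\varphi\|_{R,a}=\sup_x(R^2+|x|^2)^{-a/2}|\varphi(x)|$. $\mathcal{E}_\varepsilon$ is the set of continuous positive $\Lambda$ for which there are $c,t_0>0$ with $\int_0^{\varepsilon t}\Lambda\ge c\int_0^t\Lambda$ for all $t\ge t_0/\varepsilon$. $\mathcal{B}\varphi=B*\varphi$ with $B=\mathcal{F}^{-1}((1+|\xi|^2)^{-1})$. With $\tilde a=\max\{a_0,a\}$, a global s-solution is $u\ge0$ with $\mu=e^tu\in C([0,\infty);BC_{\tilde a})$ ($BC_{\tilde a}$: continuous functions bounded by $C|x|^{\tilde a}$ at infinity) and $\mu(t)=u_0+\int_0^t\mathcal{B}\mu\,d\tau+\int_0^te^{(1-p)\tau}\mathcal{B}[V\mu^p]\,d\tau$; it exists and is unique under these hypotheses. *)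

theory Defs
  imports "HOL-Analysis.Analysis" "HOL-Probability.Probability"
begin

definition wnorm :: "real \<Rightarrow> real \<Rightarrow> ('a::euclidean_space \<Rightarrow> real) \<Rightarrow> real" where
  "wnorm R a \<phi> = (SUP x. (R\<^sup>2 + (norm x)\<^sup>2) powr (-a/2) * \<bar>\<phi> x\<bar>)"

text \<open>BC_a: continuous functions bounded by C|x|^a at infinity
  (equivalently, for continuous functions, finite weighted sup norm).\<close>
definition BC :: "real \<Rightarrow> ('a::euclidean_space \<Rightarrow> real) set" where
  "BC a = {\<phi>. continuous_on UNIV \<phi> \<and>
      bdd_above (range (\<lambda>x. (1 + (norm x)\<^sup>2) powr (-a/2) * \<bar>\<phi> x\<bar>))}"

text \<open>The Bessel kernel B = F^{-1}((1+|xi|^2)^{-1}) on R^n, written via the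
  subordination formula (1+|xi|^2)^{-1} = int_0^inf exp(-s(1+|xi|^2)) ds.\<close>
definition bessel_kernel :: "'a::euclidean_space \<Rightarrow> real" where
  "bessel_kernel x = (LINT s:{0<..}|lborel.
      (4 * pi * s) powr (- real DIM('a) / 2) * exp (- (norm x)\<^sup>2 / (4 * s) - s))"

definition Bop :: "('a::euclidean_space \<Rightarrow> real) \<Rightarrow> 'a \<Rightarrow> real" where
  "Bop \<phi> x = (\<integral>y. bessel_kernel (x - y) * \<phi> y \<partial>lborel)"

definition class_E :: "real \<Rightarrow> (real \<Rightarrow> real) \<Rightarrow> bool" where
  "class_E \<epsilon> \<Lambda> \<longleftrightarrow> continuous_on {0..} \<Lambda> \<and> (\<forall>t\<ge>0. \<Lambda> t > 0) \<and>
     (\<exists>c t0. c > 0 \<and> t0 > 0 \<and>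
        (\<forall>t\<ge>t0/\<epsilon>. integral {0..\<epsilon>*t} \<Lambda> \<ge> c * integral {0..t} \<Lambda>))"

definition Jplus :: "nat \<Rightarrow> real set" where
  "Jplus n = (if n = 1 then {0} \<union> {1..} else {0..})"

text \<open>|x|^sigma with the convention |x|^0 = 1 (also at x = 0).\<close>
definition npow :: "real \<Rightarrow> real \<Rightarrow> real" where
  "npow r s = (if s = 0 then 1 else r powr s)"

definition s_solution :: "real \<Rightarrow> ('a::euclidean_space \<Rightarrow> real \<Rightarrow> real) \<Rightarrow> real
    \<Rightarrow> ('a \<Rightarrow> real) \<Rightarrow> ('a \<Rightarrow> real \<Rightarrow> real) \<Rightarrow> bool" where
  "s_solution p V atl u0 u \<longleftrightarrow>
     (\<forall>x t. t \<ge> 0 \<longrightarrow> u x t \<ge> 0) \<and>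
     (\<forall>t\<ge>0. (\<lambda>x. exp t * u x t) \<in> BC atl) \<and>
     (\<forall>t0\<ge>0. ((\<lambda>t. wnorm 1 atl (\<lambda>x. exp t * u x t - exp t0 * u x t0)) \<longlongrightarrow> 0)
                (at t0 within {0..})) \<and>
     (\<forall>t\<ge>0. \<forall>x. exp t * u x t =
        u0 x + integral {0..t} (\<lambda>\<tau>. Bop (\<lambda>y. exp \<tau> * u y \<tau>) x)
             + integral {0..t} (\<lambda>\<tau>. exp ((1 - p) * \<tau>) *
                  Bop (\<lambda>y. V y \<tau> * (exp \<tau> * u y \<tau>) powr p) x))"

end

theory Submission
  imports Defs
begin

text \<open>
  The Bessel kernel is an even probability density with finite moments, so \<open>\<B>\<close> is a Markov
  operator. For \<open>b > 0\<close> and \<open>k\<close> large the moving weight \<open>z = (1 + k t + |x|\<^sup>2)\<^sup>b\<close> satisfies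
  \<open>\<B> z \<le> z + \<partial>\<^sub>t z\<close>.

  Upper bound: with \<open>b = a/2\<close> and \<open>a > a\<^sub>c\<close>, \<open>V z\<^bsup>p-1\<^esup> \<le> q(t)\<close> with \<open>q\<close> integrable in time, so
  \<open>A e\<^sup>t g(t) z\<close> with \<open>g' = c q g\<close> (hence \<open>g\<close> bounded) is a supersolution. Because \<open>p < 1\<close>, the
  nonlinearity is dominated linearly near a positive supersolution, which gives comparison.

  Lower bound: for each large horizon \<open>T\<close>, \<open>u\<^sub>0\<close> dominates a multiple of
  \<open>T\<^bsup>a/2\<^esup> (|x|\<^sup>2/T - \<gamma> - \<beta> (1 + |x|\<^sup>2)\<^sup>2/T\<^sup>2)\<close>. Under the linear flow \<open>|x|\<^sup>2\<close> grows at the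
  rate \<open>m\<close>, the second moment of the kernel, and the quartic term is controlled by the moving weight
  with \<open>b = 2\<close>; evaluating the resulting subsolution at \<open>x = 0\<close>, \<open>t = T\<close> gives the growth \<open>T\<^bsup>a/2\<^esup>\<close>.
\<close>

section \<open>The Bessel kernel\<close>

text \<open>One term of the exponential series is at most its sum. This trades powers of |x| against
  half of the Gaussian decay.\<close>

lemma exp_minus_mult_power_le_fact:
  fixes x :: real
  assumes "0 \<le> x"
  shows "exp (- x) * x ^ j \<le> fact j"
proof -
  have "(\<Sum>n\<in>{j}. x ^ n /\<^sub>R fact n) \<le> exp x"
    unfolding exp_def using assms summable_exp_generic[of x] by (intro sum_le_suminf) auto
  then show ?thesis
    by (simp add: exp_minus field_simps)
qed

text \<open>The heat kernel is the product over the coordinates of normal densities of variance 2s,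
  so its integral factorises into one-dimensional integrals equal to 1.\<close>

lemma nn_integral_heat_kernel:
  fixes s :: real
  assumes "0 < s"
  shows "(\<integral>\<^sup>+(x::'a::euclidean_space). ennreal ((4 * pi * s) powr (- real DIM('a) / 2) *
            exp (- (norm x)\<^sup>2 / (4 * s))) \<partial>lborel) = 1"
proof -
  let ?f = "\<lambda>x::real. normal_density 0 (sqrt (2 * s)) x"
  have "(4 * pi * s) powr (- real DIM('a) / 2) * exp (- (norm x)\<^sup>2 / (4 * s)) =
      (\<Prod>b\<in>Basis. ?f (x \<bullet> b))" for x :: 'a
  proof -
    have "(norm x)\<^sup>2 = (\<Sum>b\<in>Basis. (x \<bullet> b)\<^sup>2)"
      unfolding power2_norm_eq_inner euclidean_inner[of x x] by (simp add: power2_eq_square)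
    then have e: "exp (- (norm x)\<^sup>2 / (4 * s)) = (\<Prod>b\<in>Basis. exp (- (x \<bullet> b)\<^sup>2 / (4 * s)))"
      by (simp add: exp_sum[symmetric] sum_negf sum_divide_distrib)
    have "(4 * pi * s) powr (- real DIM('a) / 2) = ((4 * pi * s) powr (- 1 / 2)) ^ DIM('a)"
      using assms by (simp add: powr_realpow[symmetric] powr_powr)
    also have "(4 * pi * s) powr (- 1 / 2) = 1 / sqrt (4 * pi * s)"
      using assms by (simp add: powr_minus_divide powr_half_sqrt)
    finally have c: "(4 * pi * s) powr (- real DIM('a) / 2) = (1 / sqrt (4 * pi * s)) ^ DIM('a)" .
    have f: "?f r = 1 / sqrt (4 * pi * s) * exp (- r\<^sup>2 / (4 * s))" for r
      using assms by (simp add: normal_density_def)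
    show ?thesis
      unfolding c e f by (simp only: prod.distrib prod_constant)
  qed
  then have "(\<integral>\<^sup>+(x::'a). ennreal ((4 * pi * s) powr (- real DIM('a) / 2) *
            exp (- (norm x)\<^sup>2 / (4 * s))) \<partial>lborel) =
      (\<integral>\<^sup>+(x::'a). (\<Prod>b\<in>Basis. ennreal (?f (x \<bullet> b))) \<partial>lborel)"
    by (simp add: prod_ennreal)
  also have "\<dots> = (\<Prod>b\<in>(Basis::'a set). (\<integral>\<^sup>+x. ennreal (?f x) \<partial>lborel))"
    by (intro nn_integral_lborel_prod) (auto)
  also have "(\<integral>\<^sup>+x. ennreal (?f x) \<partial>lborel) = 1"
    using assms by (subst nn_integral_eq_integral) auto
  finally show ?thesis by simp
qed

text \<open>The indicator turns the set integral over s > 0 into one over the whole line, so that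
  joint measurability and Tonelli's theorem apply directly.\<close>

definition bessel_integrand :: "real \<Rightarrow> 'a::euclidean_space \<Rightarrow> real" where
  "bessel_integrand s x = indicator {0<..} s *
     ((4 * pi * s) powr (- real DIM('a) / 2) * exp (- (norm x)\<^sup>2 / (4 * s) - s))"

lemma bessel_integrand_nonneg [simp]: "0 \<le> bessel_integrand s x"
  by (simp add: bessel_integrand_def)

lemma bessel_integrand_measurable [measurable]:
  "(\<lambda>(x::'a::euclidean_space, s). bessel_integrand s x) \<in> borel_measurable (borel \<Otimes>\<^sub>M borel)"
  unfolding bessel_integrand_def by measurable

lemma bessel_kernel_eq: "bessel_kernel x = (\<integral>s. bessel_integrand s x \<partial>lborel)"
  by (simp add: bessel_kernel_def bessel_integrand_def set_lebesgue_integral_def)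

lemma bessel_kernel_measurable [measurable]: "bessel_kernel \<in> borel_measurable borel"
  unfolding bessel_kernel_eq by measurable

lemma bessel_kernel_nonneg [simp]: "0 \<le> bessel_kernel x"
  unfolding bessel_kernel_eq by simp

lemma bessel_kernel_minus [simp]: "bessel_kernel (- x) = bessel_kernel x"
  by (simp add: bessel_kernel_def)

text \<open>Only an inequality can hold at every point: where the integrand is not integrable in s,
  as at x = 0 in dimension at least 2, the Bochner integral defaults to 0.\<close>

lemma ennreal_bessel_kernel_le:
  "ennreal (bessel_kernel x) \<le> (\<integral>\<^sup>+s. ennreal (bessel_integrand s x) \<partial>lborel)"
proof (cases "integrable lborel (\<lambda>s. bessel_integrand s x)")
  case True
  then show ?thesis unfolding bessel_kernel_eq by (subst nn_integral_eq_integral) auto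
next
  case False
  then show ?thesis unfolding bessel_kernel_eq by (simp add: not_integrable_integral_eq)
qed

lemma nn_integral_bessel_integrand_swap:
  assumes [measurable]: "f \<in> borel_measurable borel"
  shows "(\<integral>\<^sup>+(x::'a::euclidean_space). (\<integral>\<^sup>+s. ennreal (bessel_integrand s x) \<partial>lborel) * f x \<partial>lborel) =
     (\<integral>\<^sup>+s. (\<integral>\<^sup>+x. ennreal (bessel_integrand s x) * f x \<partial>lborel) \<partial>lborel)"
proof -
  have "(\<integral>\<^sup>+(x::'a). (\<integral>\<^sup>+s. ennreal (bessel_integrand s x) \<partial>lborel) * f x \<partial>lborel) =
    (\<integral>\<^sup>+(x::'a). (\<integral>\<^sup>+s. ennreal (bessel_integrand s x) * f x \<partial>lborel) \<partial>lborel)"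
    by (intro nn_integral_cong nn_integral_multc[symmetric]) measurable
  also have "\<dots> = (\<integral>\<^sup>+s. (\<integral>\<^sup>+x. ennreal (bessel_integrand s x) * f x \<partial>lborel) \<partial>lborel)"
    by (rule lborel_pair.Fubini') measurable
  finally show ?thesis .
qed

text \<open>By Tonelli the integral over x is taken first; the heat kernel has mass 1, so exp(-s) on
  s > 0 remains.\<close>

lemma nn_integral_bessel_integrand:
  "(\<integral>\<^sup>+(x::'a::euclidean_space). (\<integral>\<^sup>+s. ennreal (bessel_integrand s x) \<partial>lborel) \<partial>lborel) = 1"
proof -
  have *: "(\<integral>\<^sup>+(x::'a). ennreal (bessel_integrand s x) \<partial>lborel) =
     ennreal (exp (- s) * indicator {0<..} s)" for s
  proof (cases "0 < s")
    case True
    then have "bessel_integrand s x = ((4 * pi * s) powr (- real DIM('a) / 2) *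
         exp (- (norm x)\<^sup>2 / (4 * s))) * exp (- s)" for x :: 'a
      using exp_add[of "- (norm x)\<^sup>2 / (4 * s)" "- s"] by (simp add: bessel_integrand_def)
    then have "(\<integral>\<^sup>+(x::'a). ennreal (bessel_integrand s x) \<partial>lborel) =
      (\<integral>\<^sup>+(x::'a). ennreal ((4 * pi * s) powr (- real DIM('a) / 2) *
         exp (- (norm x)\<^sup>2 / (4 * s))) * ennreal (exp (- s)) \<partial>lborel)"
      by (simp only: ennreal_mult'' exp_ge_zero)
    also have "\<dots> = ennreal (exp (- s))"
      by (subst nn_integral_multc, measurable) (simp only: nn_integral_heat_kernel[OF True] mult_1)
    finally show ?thesis using True by simp
  qed (simp add: bessel_integrand_def)
  have "has_bochner_integral lborel (\<lambda>x. x^0 * exp (-x) * indicator {0 <..} x::real) (fact 0)"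
    by (rule has_bochner_integral_I0i_power_exp_m)
  then have "(\<integral>\<^sup>+s. ennreal (exp (- s) * indicator {0<..} s) \<partial>lborel) = 1"
    by (subst nn_integral_eq_integral) (auto simp: has_bochner_integral_iff)
  then show ?thesis
    using nn_integral_bessel_integrand_swap[where f="\<lambda>_::'a. 1"] by (simp add: *)
qed

text \<open>The total mass is finite, so the inner integral is finite for almost every x, and there
  the Bochner integral agrees with it.\<close>

lemma AE_bessel_kernel:
  "AE x::'a::euclidean_space in lborel.
     ennreal (bessel_kernel x) = (\<integral>\<^sup>+s. ennreal (bessel_integrand s x) \<partial>lborel)"
proof -
  have "AE x::'a in lborel. (\<integral>\<^sup>+s. ennreal (bessel_integrand s x) \<partial>lborel) \<noteq> \<infinity>"
    by (rule nn_integral_noteq_infinite) (auto simp: nn_integral_bessel_integrand)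
  then show ?thesis
  proof eventually_elim
    case (elim x)
    have [measurable]: "(\<lambda>s. bessel_integrand s x) \<in> borel_measurable borel"
      unfolding bessel_integrand_def by measurable
    have "integrable lborel (\<lambda>s. bessel_integrand s x)"
      using elim by (intro integrableI_nonneg) (auto simp: top.not_eq_extremum)
    then show ?case unfolding bessel_kernel_eq by (subst nn_integral_eq_integral) auto
  qed
qed

lemma nn_integral_bessel_kernel:
  "(\<integral>\<^sup>+(x::'a::euclidean_space). ennreal (bessel_kernel x) \<partial>lborel) = 1"
  using nn_integral_cong_AE[OF AE_bessel_kernel] nn_integral_bessel_integrand by (rule trans)

text \<open>The Gaussian is split into two equal factors. One absorbs |x|^(2j) at the cost of (8s)^j
  j!, the other is, up to a constant, the heat kernel at time 2s, which has mass 1.\<close>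

lemma bessel_integrand_moment_le:
  fixes x :: "'a::euclidean_space"
  assumes s: "0 < s"
  shows "bessel_integrand s x * norm x ^ (2 * j) \<le>
     fact j * 8 ^ j * 2 powr (real DIM('a) / 2) * (s ^ j * exp (- s)) *
     ((4 * pi * (2 * s)) powr (- real DIM('a) / 2) * exp (- (norm x)\<^sup>2 / (4 * (2 * s))))"
proof -
  let ?r = "(norm x)\<^sup>2 / (8 * s)"
  have e: "exp (- (norm x)\<^sup>2 / (4 * s) - s) = exp (- s) * exp (- ?r) * exp (- ?r)"
    using s by (simp add: exp_add[symmetric] field_simps)
  have n: "norm x ^ (2 * j) = (8 * s) ^ j * ?r ^ j"
    unfolding power_mult_distrib[symmetric] power_mult using s by simp
  have p: "(4 * pi * s) powr (- real DIM('a) / 2) =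
      2 powr (real DIM('a) / 2) * (4 * pi * (2 * s)) powr (- real DIM('a) / 2)"
    using s powr_mult[of 2 "4 * pi * s" "- real DIM('a) / 2"] by (simp add: powr_minus mult_ac)
  have q: "exp (- ?r) * ?r ^ j \<le> fact j"
    using s by (intro exp_minus_mult_power_le_fact) auto
  have "bessel_integrand s x * norm x ^ (2 * j) =
      2 powr (real DIM('a) / 2) * (4 * pi * (2 * s)) powr (- real DIM('a) / 2) * 
        (exp (- s) * exp (- ?r)) * (8 * s) ^ j * (exp (- ?r) * ?r ^ j)"
    unfolding bessel_integrand_def e n p using s by simp
  also have "\<dots> \<le> 2 powr (real DIM('a) / 2) * (4 * pi * (2 * s)) powr (- real DIM('a) / 2) * 
        (exp (- s) * exp (- ?r)) * (8 * s) ^ j * fact j"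
    using s by (intro mult_left_mono q) auto
  also have "\<dots> = fact j * 8 ^ j * 2 powr (real DIM('a) / 2) * (s ^ j * exp (- s)) *
     ((4 * pi * (2 * s)) powr (- real DIM('a) / 2) * exp (- ?r))"
    by (simp add: power_mult_distrib mult_ac)
  finally show ?thesis using s by (simp add: mult_ac)
qed

text \<open>After Tonelli and the splitting of the Gaussian, a multiple of the Gamma integral of s^j
  exp(-s) remains.\<close>

lemma nn_integral_bessel_kernel_even_moment:
  "(\<integral>\<^sup>+(x::'a::euclidean_space). ennreal (bessel_kernel x * norm x ^ (2 * j)) \<partial>lborel) < \<infinity>"
proof -
  let ?C = "fact j * 8 ^ j * 2 powr (real DIM('a) / 2) :: real"
  let ?h = "\<lambda>s (x::'a). (4 * pi * (2 * s)) powr (- real DIM('a) / 2) * exp (- (norm x)\<^sup>2 / (4 * (2 * s)))"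
  have *: "(\<integral>\<^sup>+(x::'a). ennreal (bessel_integrand s x) * ennreal (norm x ^ (2 * j)) \<partial>lborel) \<le>
     ennreal (?C * (s ^ j * exp (- s) * indicator {0<..} s))" for s
  proof (cases "0 < s")
    case True
    have "(\<integral>\<^sup>+(x::'a). ennreal (bessel_integrand s x) * ennreal (norm x ^ (2 * j)) \<partial>lborel) \<le>
        (\<integral>\<^sup>+(x::'a). ennreal (?C * (s ^ j * exp (- s))) * ennreal (?h s x) \<partial>lborel)"
      using bessel_integrand_moment_le[OF True] True
      by (intro nn_integral_mono) (simp add: ennreal_mult[symmetric] ennreal_leI)
    also have "\<dots> = ennreal (?C * (s ^ j * exp (- s)))"
      using True nn_integral_heat_kernel[of "2 * s", where 'a='a] by (subst nn_integral_cmult) auto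
    finally show ?thesis using True by simp
  qed (simp add: bessel_integrand_def)
  have I: "integrable lborel (\<lambda>s. ?C * (s ^ j * exp (- s) * indicator {0<..} s :: real))"
    using has_bochner_integral_I0i_power_exp_m[of j] by (auto simp: has_bochner_integral_iff)
  have "(\<integral>\<^sup>+(x::'a). ennreal (bessel_kernel x * norm x ^ (2 * j)) \<partial>lborel) \<le>
    (\<integral>\<^sup>+(x::'a). (\<integral>\<^sup>+s. ennreal (bessel_integrand s x) \<partial>lborel) * ennreal (norm x ^ (2 * j)) \<partial>lborel)"
    by (intro nn_integral_mono) (simp add: ennreal_mult ennreal_bessel_kernel_le mult_right_mono)
  also have "\<dots> = (\<integral>\<^sup>+s. (\<integral>\<^sup>+(x::'a). ennreal (bessel_integrand s x) * ennreal (norm x ^ (2 * j)) \<partial>lborel) \<partial>lborel)"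
    by (intro nn_integral_bessel_integrand_swap) measurable
  also have "\<dots> \<le> (\<integral>\<^sup>+s. ennreal (?C * (s ^ j * exp (- s) * indicator {0<..} s)) \<partial>lborel)"
    by (intro nn_integral_mono *)
  also have "\<dots> < \<infinity>"
    by (subst nn_integral_eq_integral[OF I]) (auto simp: indicator_def)
  finally show ?thesis .
qed

lemma bessel_kernel_integrable: "integrable lborel (bessel_kernel :: 'a::euclidean_space \<Rightarrow> real)"
  using nn_integral_bessel_kernel[where 'a='a] by (intro integrableI_nonneg) auto

lemma bessel_kernel_integral: "(\<integral>(x::'a::euclidean_space). bessel_kernel x \<partial>lborel) = 1"
  using nn_integral_bessel_kernel[where 'a='a] by (simp add: integral_eq_nn_integral)

lemma bessel_kernel_integrable_growth:
  "integrable lborel (\<lambda>x::'a::euclidean_space. bessel_kernel x * (1 + norm x) ^ N)"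
proof (rule Bochner_Integration.integrable_bound)
  have "integrable lborel (\<lambda>x::'a. bessel_kernel x * norm x ^ (2 * N))"
    using nn_integral_bessel_kernel_even_moment[of N, where 'a='a] by (intro integrableI_nonneg) auto
  then show "integrable lborel (\<lambda>x::'a. 4 ^ N * (bessel_kernel x + bessel_kernel x * norm x ^ (2 * N)))"
    using bessel_kernel_integrable by auto
  \<comment> \<open>Reduces arbitrary powers to the even moments: the constant covers r <= 1, and
    for larger r the base satisfies 1 + r <= 4 r^2.\<close>
  have "(1 + r) ^ N \<le> 4 ^ N * (1 + r ^ (2 * N))" if "0 \<le> r" for r :: real
  proof (cases "r \<le> 1")
    case True
    then have "(1 + r) ^ N \<le> 4 ^ N" using that by (intro power_mono) auto
    also have "\<dots> \<le> 4 ^ N * (1 + r ^ (2 * N))" using that by simp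
    finally show ?thesis .
  next
    case False
    then have "1 + r \<le> 4 * r\<^sup>2" using self_le_power[of r 2] by simp
    then have "(1 + r) ^ N \<le> (4 * r\<^sup>2) ^ N" using that by (intro power_mono) auto
    also have "\<dots> \<le> 4 ^ N * (1 + r ^ (2 * N))" by (simp add: power_mult_distrib power_mult)
    finally show ?thesis .
  qed
  from mult_left_mono[OF this[OF norm_ge_zero] bessel_kernel_nonneg]
  show "AE x::'a in lborel. norm (bessel_kernel x * (1 + norm x) ^ N)
      \<le> norm (4 ^ N * (bessel_kernel x + bessel_kernel x * norm x ^ (2 * N)))"
    by (intro always_eventually allI) (simp add: abs_mult algebra_simps)
qed measurable

section \<open>The Bessel operator on functions of polynomial growth\<close>

text \<open>A class on which the convolution converges absolutely; a natural exponent lets the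
  kernel moments apply.\<close>

definition poly_growth :: "nat \<Rightarrow> ('a::euclidean_space \<Rightarrow> real) \<Rightarrow> bool" where
  "poly_growth N \<phi> \<longleftrightarrow> \<phi> \<in> borel_measurable borel \<and> (\<exists>C. \<forall>y. \<bar>\<phi> y\<bar> \<le> C * (1 + norm y) ^ N)"

lemma poly_growthI:
  assumes "\<phi> \<in> borel_measurable borel" "\<And>y. \<bar>\<phi> y\<bar> \<le> C * (1 + norm y) ^ N"
  shows "poly_growth N \<phi>"
  using assms by (auto simp: poly_growth_def)

lemma poly_growth_cmult:
  assumes "poly_growth N \<phi>"
  shows "poly_growth N (\<lambda>y. c * \<phi> y)"
proof -
  obtain C where C: "\<phi> \<in> borel_measurable borel" "\<And>y. \<bar>\<phi> y\<bar> \<le> C * (1 + norm y) ^ N"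
    using assms by (auto simp: poly_growth_def)
  show ?thesis
  proof (rule poly_growthI)
    show "\<bar>c * \<phi> y\<bar> \<le> (\<bar>c\<bar> * C) * (1 + norm y) ^ N" for y
      using mult_left_mono[OF C(2) abs_ge_zero[of c], of y] by (simp add: abs_mult mult.assoc)
  qed (use C in measurable)
qed

lemma poly_growth_add:
  assumes "poly_growth N \<phi>" "poly_growth N \<psi>"
  shows "poly_growth N (\<lambda>y. \<phi> y + \<psi> y)"
proof -
  obtain C D where C: "\<phi> \<in> borel_measurable borel" "\<And>y. \<bar>\<phi> y\<bar> \<le> C * (1 + norm y) ^ N"
    and D: "\<psi> \<in> borel_measurable borel" "\<And>y. \<bar>\<psi> y\<bar> \<le> D * (1 + norm y) ^ N"
    using assms by (auto simp: poly_growth_def)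
  show ?thesis
  proof (rule poly_growthI)
    show "\<bar>\<phi> y + \<psi> y\<bar> \<le> (C + D) * (1 + norm y) ^ N" for y
      using C(2)[of y] D(2)[of y] by (simp add: distrib_right)
  qed (use C D in measurable)
qed

lemma poly_growth_const: "poly_growth N (\<lambda>_. c)"
  by (rule poly_growthI[where C="\<bar>c\<bar>"]) (auto simp: mult_le_cancel_left1 one_le_power)

lemma poly_growth_power: "M \<le> N \<Longrightarrow> poly_growth N (\<lambda>y. (1 + norm y) ^ M)"
  by (rule poly_growthI[where C=1]) (auto simp: power_increasing)

lemma poly_growth_norm2: "2 \<le> N \<Longrightarrow> poly_growth N (\<lambda>y. (norm y)\<^sup>2)"
proof (rule poly_growthI[where C=1])
  fix y :: 'a assume "2 \<le> N"
  have "(norm y)\<^sup>2 \<le> (1 + norm y)\<^sup>2" by (intro power_mono) auto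
  also have "\<dots> \<le> (1 + norm y) ^ N" using \<open>2 \<le> N\<close> by (intro power_increasing) auto
  finally show "\<bar>(norm y)\<^sup>2\<bar> \<le> 1 * (1 + norm y) ^ N" by simp
qed measurable

text \<open>Submultiplicativity separates growth at x + y into a factor in x and one that the kernel
  integrates.\<close>

lemma one_plus_norm_add_le:
  "1 + norm (x + y) \<le> (1 + norm x) * (1 + norm (y::'a::real_normed_vector))"
proof -
  have "(1 + norm x) * (1 + norm y) = 1 + (norm x + norm y) + norm x * norm y"
    by (simp add: algebra_simps)
  moreover have "0 \<le> norm x * norm y" by simp
  ultimately show ?thesis using norm_triangle_ineq[of x y] by linarith
qed

lemma integrable_bessel_kernel_shift:
  assumes "poly_growth N \<phi>"
  shows "integrable lborel (\<lambda>y::'a::euclidean_space. bessel_kernel y * \<phi> (x + y))"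
proof -
  obtain C where [measurable]: "\<phi> \<in> borel_measurable borel" and C: "\<And>y. \<bar>\<phi> y\<bar> \<le> C * (1 + norm y) ^ N"
    using assms by (auto simp: poly_growth_def)
  have C0: "0 \<le> C"
    using C[of 0] by simp
  show ?thesis
  proof (rule Bochner_Integration.integrable_bound)
    show "integrable lborel (\<lambda>y::'a. C * (1 + norm x) ^ N * (bessel_kernel y * (1 + norm y) ^ N))"
      using bessel_kernel_integrable_growth[of N, where 'a='a] by simp
    show "AE y::'a in lborel. norm (bessel_kernel y * \<phi> (x + y))
      \<le> norm (C * (1 + norm x) ^ N * (bessel_kernel y * (1 + norm y) ^ N))"
    proof (intro always_eventually allI)
      fix y :: 'a
      have "\<bar>\<phi> (x + y)\<bar> \<le> C * (1 + norm (x + y)) ^ N" by (rule C)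
      also have "\<dots> \<le> C * ((1 + norm x) * (1 + norm y)) ^ N"
        using C0 by (intro mult_left_mono power_mono one_plus_norm_add_le) auto
      finally have "bessel_kernel y * \<bar>\<phi> (x + y)\<bar> \<le>
          bessel_kernel y * (C * ((1 + norm x) * (1 + norm y)) ^ N)"
        by (intro mult_left_mono) auto
      then show "norm (bessel_kernel y * \<phi> (x + y))
        \<le> norm (C * (1 + norm x) ^ N * (bessel_kernel y * (1 + norm y) ^ N))"
        using C0 by (simp add: abs_mult power_mult_distrib mult_ac)
    qed
  qed measurable
qed

lemma integrable_Bop:
  assumes "poly_growth N \<phi>"
  shows "integrable lborel (\<lambda>y::'a::euclidean_space. bessel_kernel (x - y) * \<phi> y)"
proof -
  have [measurable]: "\<phi> \<in> borel_measurable borel"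
    using assms by (auto simp: poly_growth_def)
  have "integrable (distr lborel borel ((+) x)) (\<lambda>y. bessel_kernel (x - y) * \<phi> y)"
    by (subst integrable_distr_eq) (auto intro: integrable_bessel_kernel_shift[OF assms])
  then show ?thesis by (simp add: lborel_distr_plus)
qed

text \<open>Translation by x and evenness of the kernel give an average over displacements y, the
  form suited to expanding \<open>\<phi>\<close> around x.\<close>

lemma Bop_shift:
  assumes [measurable]: "\<phi> \<in> borel_measurable borel"
  shows "Bop \<phi> x = (\<integral>(y::'a::euclidean_space). bessel_kernel y * \<phi> (x + y) \<partial>lborel)"
proof -
  have "Bop \<phi> x = (\<integral>y. bessel_kernel (x - y) * \<phi> y \<partial>distr lborel borel ((+) x))"
    by (simp add: Bop_def lborel_distr_plus)
  also have "\<dots> = (\<integral>y. bessel_kernel y * \<phi> (x + y) \<partial>lborel)"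
    by (subst integral_distr) auto
  finally show ?thesis .
qed

text \<open>If the smaller integrand is not integrable, its integral is 0 by convention, which the
  sign condition on \<open>\<psi>\<close> covers. This form serves the nonlinear term, whose
  integrability is not established separately.\<close>

lemma Bop_mono:
  assumes "poly_growth N \<psi>" "\<And>y. \<phi> y \<le> \<psi> y" "\<And>y. 0 \<le> \<psi> y"
  shows "Bop \<phi> x \<le> Bop \<psi> x"
  unfolding Bop_def using assms
  by (intro integral_mono' integrable_Bop) (auto intro: mult_left_mono)

lemma Bop_mono_growth:
  assumes "poly_growth N \<phi>" "poly_growth N \<psi>" "\<And>y. \<phi> y \<le> \<psi> y"
  shows "Bop \<phi> x \<le> Bop \<psi> x"
  unfolding Bop_def using assms
  by (intro integral_mono integrable_Bop[OF assms(1)] integrable_Bop[OF assms(2)]) (auto intro: mult_left_mono)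

lemma Bop_nonneg: "(\<And>y. 0 \<le> \<phi> y) \<Longrightarrow> 0 \<le> Bop \<phi> x"
  unfolding Bop_def by (intro integral_nonneg_AE always_eventually) simp

lemma Bop_add:
  assumes "poly_growth N \<phi>" "poly_growth N \<psi>"
  shows "Bop (\<lambda>y. \<phi> y + \<psi> y) x = Bop \<phi> x + Bop \<psi> x"
  unfolding Bop_def distrib_left
  by (intro Bochner_Integration.integral_add integrable_Bop[OF assms(1)] integrable_Bop[OF assms(2)])

lemma Bop_cmult: "Bop (\<lambda>y. c * \<phi> y) x = c * Bop \<phi> x"
  unfolding Bop_def by (simp add: mult.left_commute)

lemma Bop_const [simp]: "Bop (\<lambda>_::'a::euclidean_space. c) x = c"
  by (simp add: Bop_shift bessel_kernel_integral)

section \<open>Action of the operator on powers and on the squared norm\<close>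

definition bessel_growth_const :: "'a::euclidean_space itself \<Rightarrow> nat \<Rightarrow> real" where
  "bessel_growth_const _ N = (\<integral>(y::'a). bessel_kernel y * (1 + norm y) ^ N \<partial>lborel)"

lemma bessel_growth_const_ge_1: "1 \<le> bessel_growth_const TYPE('a::euclidean_space) N"
proof -
  have "(\<integral>(y::'a). bessel_kernel y * 1 \<partial>lborel) \<le> (\<integral>(y::'a). bessel_kernel y * (1 + norm y) ^ N \<partial>lborel)"
    using bessel_kernel_integrable
    by (intro integral_mono bessel_kernel_integrable_growth mult_left_mono) (auto simp: one_le_power)
  then show ?thesis by (simp add: bessel_growth_const_def bessel_kernel_integral)
qed

text \<open>Integrating the submultiplicative bound reproduces the weight up to a constant, which
  makes it the spatial factor of the comparison arguments.\<close>

lemma Bop_power_le: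
  fixes x :: "'a::euclidean_space"
  shows "Bop (\<lambda>y. (1 + norm y) ^ N) x \<le> bessel_growth_const TYPE('a) N * (1 + norm x) ^ N"
proof -
  have "Bop (\<lambda>y. (1 + norm y) ^ N) x = (\<integral>(y::'a). bessel_kernel y * (1 + norm (x + y)) ^ N \<partial>lborel)"
    by (rule Bop_shift) measurable
  also have "\<dots> \<le> (\<integral>(y::'a). (1 + norm x) ^ N * (bessel_kernel y * (1 + norm y) ^ N) \<partial>lborel)"
  proof (intro integral_mono)
    fix y :: 'a
    have "(1 + norm (x + y)) ^ N \<le> ((1 + norm x) * (1 + norm y)) ^ N"
      by (intro power_mono one_plus_norm_add_le) auto
    then have "bessel_kernel y * (1 + norm (x + y)) ^ N \<le> bessel_kernel y * ((1 + norm x) * (1 + norm y)) ^ N"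
      by (intro mult_left_mono) auto
    then show "bessel_kernel y * (1 + norm (x + y)) ^ N \<le> (1 + norm x) ^ N * (bessel_kernel y * (1 + norm y) ^ N)"
      by (simp add: power_mult_distrib mult_ac)
  qed (use bessel_kernel_integrable_growth integrable_bessel_kernel_shift[OF poly_growth_power[OF order_refl]] in auto)
  finally show ?thesis by (simp add: bessel_growth_const_def mult.commute)
qed

lemma integrable_bessel_kernel_inner:
  "integrable lborel (\<lambda>y::'a::euclidean_space. bessel_kernel y * (x \<bullet> y))"
proof (rule Bochner_Integration.integrable_bound)
  show "integrable lborel (\<lambda>y::'a. norm x * (bessel_kernel y * (1 + norm y) ^ 1))"
    using bessel_kernel_integrable_growth[of 1, where 'a='a] by simp
  have "\<bar>x \<bullet> y\<bar> \<le> norm x * (1 + norm y)" for y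
    using Cauchy_Schwarz_ineq2[of x y] by (simp add: distrib_left add_increasing)
  from mult_left_mono[OF this bessel_kernel_nonneg]
  show "AE y::'a in lborel. norm (bessel_kernel y * (x \<bullet> y)) \<le> norm (norm x * (bessel_kernel y * (1 + norm y) ^ 1))"
    by (intro always_eventually allI) (simp add: abs_mult mult_ac)
qed measurable

text \<open>Under the reflection of y the kernel is even and the linear form odd, so the integral
  equals its own negative.\<close>

lemma bessel_kernel_integral_inner:
  "(\<integral>(y::'a::euclidean_space). bessel_kernel y * (x \<bullet> y) \<partial>lborel) = 0"
proof -
  have "(lborel :: 'a measure) = distr lborel borel uminus"
    by (subst lborel_affine[of "-1" 0]) (auto simp: density_1 one_ennreal_def[symmetric] minus_equation_iff)
  then have "(\<integral>(y::'a). bessel_kernel y * (x \<bullet> y) \<partial>lborel) =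
      (\<integral>(y::'a). bessel_kernel y * (x \<bullet> y) \<partial>distr lborel borel uminus)"
    by simp
  also have "\<dots> = - (\<integral>(y::'a). bessel_kernel y * (x \<bullet> y) \<partial>lborel)"
    by (subst integral_distr) auto
  finally show ?thesis by simp
qed

definition bessel_second_moment :: "'a::euclidean_space itself \<Rightarrow> real" where
  "bessel_second_moment _ = (\<integral>(y::'a). bessel_kernel y * (norm y)\<^sup>2 \<partial>lborel)"

lemma integrable_bessel_second_moment:
  "integrable lborel (\<lambda>y::'a::euclidean_space. bessel_kernel y * (norm y)\<^sup>2)"
  using integrable_bessel_kernel_shift[OF poly_growth_norm2[OF order_refl], of 0] by simp

text \<open>A vanishing moment would make the kernel vanish almost everywhere off the origin, hence
  almost everywhere, against its mass 1.\<close>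

lemma bessel_second_moment_pos: "0 < bessel_second_moment TYPE('a::euclidean_space)"
proof -
  have "bessel_second_moment TYPE('a) \<noteq> 0"
  proof
    assume "bessel_second_moment TYPE('a) = 0"
    then have "AE y::'a in lborel. bessel_kernel y * (norm y)\<^sup>2 = 0"
      unfolding bessel_second_moment_def
      by (subst (asm) integral_nonneg_eq_0_iff_AE) (auto intro: integrable_bessel_second_moment)
    with AE_lborel_singleton[of "0::'a"] have "AE y::'a in lborel. bessel_kernel y = 0"
      by eventually_elim auto
    then have "(\<integral>(y::'a). bessel_kernel y \<partial>lborel) = 0"
      by (rule integral_eq_zero_AE)
    then show False by (simp add: bessel_kernel_integral)
  qed
  moreover have "0 \<le> bessel_second_moment TYPE('a)"
    unfolding bessel_second_moment_def by (intro integral_nonneg_AE always_eventually) simp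
  ultimately show ?thesis by simp
qed

lemma norm_add_power2: "(norm (x + y))\<^sup>2 = (norm x)\<^sup>2 + 2 * (x \<bullet> y) + (norm (y::'a::real_inner))\<^sup>2"
  by (simp add: power2_norm_eq_inner inner_add inner_commute)

text \<open>The linear term of |x + y|^2 integrates to zero. The added constant is the growth rate
  that drives the lower bound.\<close>

lemma Bop_norm2:
  fixes x :: "'a::euclidean_space"
  shows "Bop (\<lambda>y. (norm y)\<^sup>2) x = (norm x)\<^sup>2 + bessel_second_moment TYPE('a)"
proof -
  have "Bop (\<lambda>y. (norm y)\<^sup>2) x = (\<integral>(y::'a). bessel_kernel y * (norm (x + y))\<^sup>2 \<partial>lborel)"
    by (rule Bop_shift) measurable
  also have "\<dots> = (\<integral>(y::'a). (norm x)\<^sup>2 * bessel_kernel y + 2 * (bessel_kernel y * (x \<bullet> y))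
      + bessel_kernel y * (norm y)\<^sup>2 \<partial>lborel)"
    by (simp add: norm_add_power2 distrib_left mult_ac)
  also have "\<dots> = (norm x)\<^sup>2 + bessel_second_moment TYPE('a)"
    using bessel_kernel_integrable[where 'a='a] integrable_bessel_kernel_inner[of x] integrable_bessel_second_moment[where 'a='a]
    by (simp add: bessel_kernel_integral bessel_kernel_integral_inner bessel_second_moment_def)
  finally show ?thesis .
qed

section \<open>Second-order expansion and the moving weight\<close>

lemma one_plus_power_le_quadratic:
  fixes q e s :: real
  assumes s: "1 \<le> s" and e: "0 \<le> e" and q: "\<bar>q\<bar> \<le> e / sqrt s" and m: "1 \<le> m"
  shows "(1 + q) ^ m \<le> 1 + real m * q + (1 + e) ^ m / s"
proof -
  have "(1 + q) ^ m = (\<Sum>j\<le>m. real (m choose j) * q ^ j)"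
    using binomial_ring[of q 1 m] by (simp add: add.commute)
  also have "\<dots> \<le> (\<Sum>j\<le>m. (if j = 0 then 1 else 0) + (if j = 1 then real m * q else 0)
      + real (m choose j) * e ^ j / s)"
  proof (rule sum_mono)
    fix j :: nat
    consider "j = 0" | "j = 1" | "2 \<le> j" by linarith
    then show "real (m choose j) * q ^ j \<le> (if j = 0 then 1 else 0) + (if j = 1 then real m * q else 0)
      + real (m choose j) * e ^ j / s"
    proof cases
      \<comment> \<open>Orders two and higher: |q|^j <= e^j / s^(j/2) <= e^j / s because s >= 1. The
        order-one term is kept exactly, since its part linear in y cancels on integration.\<close>
      case 3
      have "q ^ j \<le> \<bar>q\<bar> ^ j" by (simp add: power_abs[symmetric])
      also have "\<dots> \<le> (e / sqrt s) ^ j" using q by (intro power_mono) auto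
      also have "\<dots> = e ^ j / sqrt s ^ j" by (simp add: power_divide)
      also have "\<dots> \<le> e ^ j / s"
      proof (intro divide_left_mono)
        have "sqrt s ^ 2 \<le> sqrt s ^ j" using s 3 by (intro power_increasing) auto
        then show "s \<le> sqrt s ^ j" using s by simp
      qed (use s e in auto)
      finally have "real (m choose j) * q ^ j \<le> real (m choose j) * (e ^ j / s)"
        by (intro mult_left_mono) auto
      then show ?thesis using 3 by simp
    qed (use s e in auto)
  qed
  also have "\<dots> = 1 + real m * q + (\<Sum>j\<le>m. real (m choose j) * e ^ j) / s"
    using m by (simp add: sum.distrib sum.delta sum_divide_distrib)
  also have "(\<Sum>j\<le>m. real (m choose j) * e ^ j) = (1 + e) ^ m"
    using binomial_ring[of e 1 m] by (simp add: add.commute)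
  finally show ?thesis .
qed

text \<open>Concavity of the power, in the form of Young's inequality for x and 1.\<close>

lemma powr_le_tangent_at_1:
  fixes x :: real
  assumes "0 < x" "0 < \<theta>" "\<theta> \<le> 1"
  shows "x powr \<theta> \<le> 1 + \<theta> * (x - 1)"
  using Youngs_inequality_0[of \<theta> "1 - \<theta>" x 1] assms by (simp add: algebra_simps)

text \<open>The natural exponent \<open>m \<ge> b\<close> reduces the estimate to the binomial theorem and the tangent
  line of the concave function \<open>y\<^bsup>b/m\<^esup>\<close>.\<close>
lemma powr_add_le_quadratic:
  fixes s h e b :: real
  assumes s: "1 \<le> s" and sh: "0 < s + h" and e: "0 \<le> e" and h: "\<bar>h\<bar> \<le> sqrt s * e"
    and b: "0 < b" and m: "1 \<le> m" "b \<le> real m"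
  shows "(s + h) powr b \<le> s powr b + b * s powr (b - 1) * (h + (1 + e) ^ m / real m)"
proof -
  define q where "q = h / s"
  have s0: "0 < s" using s by simp
  have "\<bar>q\<bar> \<le> sqrt s * e / s" using h s0 by (simp add: q_def divide_right_mono)
  also have "\<dots> = e / sqrt s" using s0 real_div_sqrt[of s] by (simp add: field_simps)
  finally have q: "(1 + q) ^ m \<le> 1 + real m * q + (1 + e) ^ m / s"
    using s e m by (intro one_plus_power_le_quadratic) auto
  have q1: "0 < 1 + q" using sh s0 by (simp add: q_def field_simps)
  have "(1 + q) powr b = ((1 + q) ^ m) powr (b / real m)"
    using q1 m by (simp add: powr_realpow[symmetric] powr_powr)
  also have "\<dots> \<le> 1 + b / real m * ((1 + q) ^ m - 1)"
    using q1 m b by (intro powr_le_tangent_at_1) auto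
  also have "\<dots> \<le> 1 + b / real m * (real m * q + (1 + e) ^ m / s)"
    using q b m by (intro add_left_mono mult_left_mono) auto
  also have "\<dots> = 1 + b * (h + (1 + e) ^ m / real m) / s"
    using m s0 by (simp add: q_def field_simps)
  finally have *: "(1 + q) powr b \<le> 1 + b * (h + (1 + e) ^ m / real m) / s" .
  have "s + h = s * (1 + q)" using s0 by (simp add: q_def field_simps)
  then have "(s + h) powr b = s powr b * (1 + q) powr b" using s0 q1 by (simp add: powr_mult)
  also have "\<dots> \<le> s powr b * (1 + b * (h + (1 + e) ^ m / real m) / s)"
    using * by (intro mult_left_mono) auto
  also have "\<dots> = s powr b + b * s powr (b - 1) * (h + (1 + e) ^ m / real m)"
    using s0 by (simp add: powr_diff field_simps)
  finally show ?thesis .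
qed

text \<open>Time enters as a shift of 1 + |x|^2, so the time derivative is b k times the weight with
  exponent b - 1. This has the same shape as the second-order error of the operator.\<close>

definition moving_weight :: "real \<Rightarrow> real \<Rightarrow> real \<Rightarrow> 'a::euclidean_space \<Rightarrow> real" where
  "moving_weight b k t x = (1 + k * t + (norm x)\<^sup>2) powr b"

lemma moving_weight_nonneg [simp]: "0 \<le> moving_weight b k t x"
  by (simp add: moving_weight_def)

lemma moving_weight_measurable [measurable]: "moving_weight b k t \<in> borel_measurable borel"
  unfolding moving_weight_def[abs_def] by measurable

lemma moving_weight_growth:
  assumes "0 \<le> b" "2 * b \<le> real N" "0 \<le> k" "0 \<le> t"
  shows "moving_weight b k t x \<le> (1 + k * t) powr b * (1 + norm x) ^ N"
proof -
  have kt: "0 \<le> k * t" using assms by simp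
  have "1 + k * t + (norm x)\<^sup>2 \<le> (1 + k * t) * (1 + norm x)\<^sup>2"
  proof -
    have "(norm x)\<^sup>2 \<le> (1 + k * t) * (norm x)\<^sup>2"
      using mult_right_mono[of 1 "1 + k * t" "(norm x)\<^sup>2"] kt by simp
    moreover have "0 \<le> (1 + k * t) * (2 * norm x)" using kt by (intro mult_nonneg_nonneg) auto
    ultimately show ?thesis by (simp add: power2_eq_square algebra_simps)
  qed
  then have "moving_weight b k t x \<le> ((1 + k * t) * (1 + norm x)\<^sup>2) powr b"
    unfolding moving_weight_def using assms kt by (intro powr_mono2) (auto intro: add_nonneg_nonneg)
  also have "\<dots> = (1 + k * t) powr b * (1 + norm x) powr (2 * b)"
    using kt powr_powr[of "1 + norm x" 2 b] by (simp add: powr_mult)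
  also have "\<dots> \<le> (1 + k * t) powr b * (1 + norm x) powr (real N)"
    using assms by (intro mult_left_mono powr_mono) auto
  finally show ?thesis by (simp add: powr_realpow add_pos_nonneg)
qed

lemma poly_growth_moving_weight:
  assumes "0 \<le> b" "2 * b \<le> real N" "0 \<le> k" "0 \<le> t"
  shows "poly_growth N (moving_weight b k t)"
  using moving_weight_growth[OF assms] by (intro poly_growthI) auto

text \<open>Expanding around x, the part linear in y averages out and the rest is a fixed
  combination of kernel moments times b s^(b-1). For k above that combination it is dominated by the
  time derivative of the weight, which is the last summand.\<close>

lemma Bop_moving_weight_le:
  assumes b: "0 < b"
  shows "\<exists>K\<ge>1. \<forall>k\<ge>K. \<forall>t\<ge>0. \<forall>x::'a::euclidean_space.
     Bop (moving_weight b k t) x \<le> moving_weight b k t x + b * k * moving_weight (b - 1) k t x"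
proof -
  obtain m' :: nat where "b \<le> real m'" using real_arch_simple by blast
  then obtain m :: nat where m: "1 \<le> m" "b \<le> real m"
    using that[of "Suc m'"] by auto
  \<comment> \<open>The second moment comes from |y|^2 in the increment, the other summand from the
    integrated binomial remainder.\<close>
  define K where "K = max 1 (bessel_second_moment TYPE('a) + bessel_growth_const TYPE('a) (2 * m) / real m)"
  show ?thesis
  proof (intro exI[of _ K] conjI allI impI)
    fix k t :: real and x :: 'a
    assume k: "K \<le> k" and t: "0 \<le> t"
    define s where "s = 1 + k * t + (norm x)\<^sup>2"
    have kt: "0 \<le> k * t" using k t by (simp add: K_def)
    have s: "1 \<le> s" "norm x \<le> sqrt s" "1 \<le> sqrt s" using kt by (auto simp: s_def intro: real_le_rsqrt)
    obtain N :: nat where N: "2 * b \<le> real N" using real_arch_simple by blast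
    have pg: "poly_growth N (moving_weight b k t :: 'a \<Rightarrow> real)"
      using N b k t by (intro poly_growth_moving_weight) (auto simp: K_def)
    have pw: "moving_weight b k t (x + y) \<le> s powr b + b * s powr (b - 1) *
        (2 * (x \<bullet> y) + (norm y)\<^sup>2 + (1 + norm y) ^ (2 * m) / real m)" for y
    proof -
      define h where "h = 2 * (x \<bullet> y) + (norm y)\<^sup>2"
      have sh: "s + h = 1 + k * t + (norm (x + y))\<^sup>2"
        by (simp add: s_def h_def norm_add_power2)
      \<comment> \<open>Since |x| and 1 are at most sqrt(s), the expansion applies with e = 2|y| +
        |y|^2, for which 1 + e = (1 + |y|)^2.\<close>
      have "\<bar>h\<bar> \<le> 2 * (norm x * norm y) + (norm y)\<^sup>2"
        using Cauchy_Schwarz_ineq2[of x y] abs_triangle_ineq[of "2 * (x \<bullet> y)" "(norm y)\<^sup>2"]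
        by (simp add: h_def abs_mult)
      also have "\<dots> \<le> 2 * (sqrt s * norm y) + sqrt s * (norm y)\<^sup>2"
        using s mult_right_mono[of 1 "sqrt s" "(norm y)\<^sup>2"]
        by (intro add_mono mult_left_mono mult_right_mono) auto
      finally have h: "\<bar>h\<bar> \<le> sqrt s * (2 * norm y + (norm y)\<^sup>2)"
        by (simp add: algebra_simps)
      have "(s + h) powr b \<le> s powr b + b * s powr (b - 1) * (h + (1 + (2 * norm y + (norm y)\<^sup>2)) ^ m / real m)"
        using s h b m kt by (intro powr_add_le_quadratic) (auto simp: sh intro: add_pos_nonneg)
      moreover have "1 + (2 * norm y + (norm y)\<^sup>2) = (1 + norm y)\<^sup>2"
        by (simp add: power2_eq_square algebra_simps)
      ultimately show ?thesis by (simp add: moving_weight_def sh[symmetric] power_mult h_def[symmetric])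
    qed
    have i: "integrable lborel (\<lambda>y::'a. s powr b * bessel_kernel y + b * s powr (b - 1) *
        (2 * (bessel_kernel y * (x \<bullet> y)) + bessel_kernel y * (norm y)\<^sup>2
         + (bessel_kernel y * (1 + norm y) ^ (2 * m)) / real m))"
      using bessel_kernel_integrable[where 'a='a] integrable_bessel_kernel_inner[of x] integrable_bessel_second_moment[where 'a='a]
        bessel_kernel_integrable_growth[of "2 * m", where 'a='a] by auto
    have "Bop (moving_weight b k t) x = (\<integral>(y::'a). bessel_kernel y * moving_weight b k t (x + y) \<partial>lborel)"
      by (rule Bop_shift) measurable
    also have "\<dots> \<le> (\<integral>(y::'a). s powr b * bessel_kernel y + b * s powr (b - 1) *
        (2 * (bessel_kernel y * (x \<bullet> y)) + bessel_kernel y * (norm y)\<^sup>2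
         + (bessel_kernel y * (1 + norm y) ^ (2 * m)) / real m) \<partial>lborel)"
    proof (intro integral_mono i integrable_bessel_kernel_shift[OF pg])
      fix y :: 'a
      show "bessel_kernel y * moving_weight b k t (x + y) \<le> s powr b * bessel_kernel y + b * s powr (b - 1) *
        (2 * (bessel_kernel y * (x \<bullet> y)) + bessel_kernel y * (norm y)\<^sup>2
         + (bessel_kernel y * (1 + norm y) ^ (2 * m)) / real m)"
        using mult_left_mono[OF pw[of y] bessel_kernel_nonneg[of y]] by (simp add: algebra_simps)
    qed
    also have "\<dots> = s powr b + b * s powr (b - 1) *
        (bessel_second_moment TYPE('a) + bessel_growth_const TYPE('a) (2 * m) / real m)"
      using bessel_kernel_integrable[where 'a='a] integrable_bessel_kernel_inner[of x] integrable_bessel_second_moment[where 'a='a]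
        bessel_kernel_integrable_growth[of "2 * m", where 'a='a]
      by (simp add: bessel_kernel_integral bessel_kernel_integral_inner bessel_second_moment_def
          bessel_growth_const_def)
    also have "\<dots> \<le> s powr b + b * s powr (b - 1) * k"
      using k b by (intro add_left_mono mult_left_mono) (auto simp: K_def)
    finally show "Bop (moving_weight b k t) x \<le> moving_weight b k t x + b * k * moving_weight (b - 1) k t x"
      by (simp add: moving_weight_def s_def mult_ac)
  qed (simp add: K_def)
qed

section \<open>Comparison principles\<close>

lemma BC_abs_le_wnorm:
  assumes "f \<in> BC a"
  shows "(1 + (norm x)\<^sup>2) powr (- a / 2) * \<bar>f x\<bar> \<le> wnorm 1 a f"
  using assms unfolding wnorm_def BC_def one_power2 mem_Collect_eq by (intro cSUP_upper) auto

lemma BC_wnorm_nonneg: "f \<in> BC a \<Longrightarrow> 0 \<le> wnorm 1 a f"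
  by (rule order_trans[OF _ BC_abs_le_wnorm[of f a 0]]) simp_all

lemma BC_diff:
  assumes "f \<in> BC a" "g \<in> BC a"
  shows "(\<lambda>x. f x - g x) \<in> BC a"
  unfolding BC_def
proof (intro CollectI conjI bdd_aboveI2)
  fix x
  have "(1 + (norm x)\<^sup>2) powr (- a / 2) * \<bar>f x - g x\<bar> \<le>
      (1 + (norm x)\<^sup>2) powr (- a / 2) * (\<bar>f x\<bar> + \<bar>g x\<bar>)"
    by (intro mult_left_mono) auto
  also have "\<dots> \<le> wnorm 1 a f + wnorm 1 a g"
    unfolding distrib_left by (intro add_mono BC_abs_le_wnorm assms)
  finally show "(1 + (norm x)\<^sup>2) powr (- a / 2) * \<bar>f x - g x\<bar> \<le> wnorm 1 a f + wnorm 1 a g" .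
qed (use assms in \<open>auto simp: BC_def intro: continuous_on_diff\<close>)

lemma wnorm_diff_commute: "wnorm R a (\<lambda>x. f x - g x) = wnorm R a (\<lambda>x. g x - f x)"
  by (simp add: wnorm_def abs_minus_commute)

lemma wnorm_le_wnorm_diff:
  assumes "f \<in> BC a" "g \<in> BC a"
  shows "wnorm 1 a f \<le> wnorm 1 a g + wnorm 1 a (\<lambda>x. f x - g x)"
proof -
  have "(1 + (norm x)\<^sup>2) powr (- a / 2) * \<bar>f x\<bar> \<le> wnorm 1 a g + wnorm 1 a (\<lambda>x. f x - g x)" for x
  proof -
    have "(1 + (norm x)\<^sup>2) powr (- a / 2) * \<bar>f x\<bar> \<le>
        (1 + (norm x)\<^sup>2) powr (- a / 2) * (\<bar>g x\<bar> + \<bar>f x - g x\<bar>)"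
      by (intro mult_left_mono) auto
    also have "\<dots> \<le> wnorm 1 a g + wnorm 1 a (\<lambda>x. f x - g x)"
      unfolding distrib_left using BC_abs_le_wnorm[OF assms(2)] BC_abs_le_wnorm[OF BC_diff[OF assms]]
      by (intro add_mono) auto
    finally show ?thesis .
  qed
  then show ?thesis
    unfolding wnorm_def[of 1 a f] by (intro cSUP_least) (auto simp del: minus_divide_left)
qed

lemma BC_abs_le_weight:
  assumes f: "f \<in> BC a"
  shows "\<bar>f x\<bar> \<le> wnorm 1 a f * (1 + (norm x)\<^sup>2) powr (a / 2)"
proof -
  let ?w = "(1 + (norm x)\<^sup>2) powr (a / 2)"
  have p: "0 < 1 + (norm x)\<^sup>2" by (simp add: add_pos_nonneg)
  have "\<bar>f x\<bar> = ?w * ((1 + (norm x)\<^sup>2) powr (- a / 2) * \<bar>f x\<bar>)"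
    using p by (simp add: powr_minus mult.assoc[symmetric])
  also have "\<dots> \<le> ?w * wnorm 1 a f"
    using BC_abs_le_wnorm[OF f] by (intro mult_left_mono) auto
  finally show ?thesis by (simp add: mult.commute)
qed

lemma BC_abs_le_growth:
  fixes x :: "'a::euclidean_space"
  assumes f: "f \<in> BC a" and a: "0 \<le> a" "a \<le> real N"
  shows "\<bar>f x\<bar> \<le> wnorm 1 a f * (1 + norm x) ^ N"
proof (rule order_trans[OF BC_abs_le_weight[OF f] mult_left_mono])
  show "(1 + (norm x)\<^sup>2) powr (a / 2) \<le> (1 + norm x) ^ N"
    using moving_weight_growth[of "a / 2" N 0 0 x] a by (simp add: moving_weight_def)
qed (rule BC_wnorm_nonneg[OF f])

lemma BC_poly_growth:
  assumes f: "f \<in> BC a" and a: "0 \<le> a" "a \<le> real N"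
  shows "poly_growth N f"
  using f BC_abs_le_growth[OF assms]
  by (intro poly_growthI borel_measurable_continuous_onI) (auto simp: BC_def)

text \<open>Monotonicity is applied to f <= g + |f - g| with the difference bounded by its norm
  times the weight; exchanging f and g gives the absolute value.\<close>

lemma Bop_BC_diff_le:
  fixes x :: "'a::euclidean_space"
  assumes f: "f \<in> BC a" "g \<in> BC a" and a: "0 \<le> a" "a \<le> real N"
  shows "\<bar>Bop f x - Bop g x\<bar> \<le>
    wnorm 1 a (\<lambda>x. f x - g x) * (bessel_growth_const TYPE('a) N * (1 + norm x) ^ N)"
proof -
  have le: "Bop f x \<le> Bop g x +
      wnorm 1 a (\<lambda>x. f x - g x) * (bessel_growth_const TYPE('a) N * (1 + norm x) ^ N)"
    if f: "f \<in> BC a" "g \<in> BC a" for f g :: "'a \<Rightarrow> real"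
  proof -
    let ?w = "wnorm 1 a (\<lambda>x. f x - g x)"
    have g: "poly_growth N (\<lambda>y. ?w * (1 + norm (y::'a)) ^ N)"
      by (intro poly_growth_cmult poly_growth_power) auto
    have "Bop f x \<le> Bop (\<lambda>y. g y + ?w * (1 + norm y) ^ N) x"
    proof (rule Bop_mono_growth[where N=N])
      show "f y \<le> g y + ?w * (1 + norm y) ^ N" for y
        using BC_abs_le_growth[OF BC_diff[OF f] a, of y] by auto
    qed (intro BC_poly_growth[OF _ a] poly_growth_add g f)+
    also have "\<dots> = Bop g x + ?w * Bop (\<lambda>y. (1 + norm y) ^ N) x"
      by (subst Bop_add[OF BC_poly_growth[OF f(2) a] g]) (simp add: Bop_cmult)
    also have "\<dots> \<le> Bop g x + ?w * (bessel_growth_const TYPE('a) N * (1 + norm x) ^ N)"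
      by (intro add_left_mono mult_left_mono Bop_power_le BC_wnorm_nonneg BC_diff f)
    finally show ?thesis .
  qed
  from le[OF f] le[OF f(2) f(1)] show ?thesis
    by (subst (asm) (2) wnorm_diff_commute) (simp add: abs_le_iff)
qed

context
  fixes p a :: real and V :: "'a::euclidean_space \<Rightarrow> real \<Rightarrow> real" and u0 :: "'a \<Rightarrow> real"
    and u :: "'a \<Rightarrow> real \<Rightarrow> real" and N :: nat
  assumes sol: "s_solution p V a u0 u" and a: "0 \<le> a" "a \<le> real N"
begin

lemma s_solution_nonneg: "0 \<le> t \<Longrightarrow> 0 \<le> u x t"
  using sol by (auto simp: s_solution_def)

lemma s_solution_BC: "0 \<le> t \<Longrightarrow> (\<lambda>x. exp t * u x t) \<in> BC a"
  using sol by (auto simp: s_solution_def)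

lemma s_solution_continuous:
  "0 \<le> t0 \<Longrightarrow> ((\<lambda>t. wnorm 1 a (\<lambda>x. exp t * u x t - exp t0 * u x t0)) \<longlongrightarrow> 0) (at t0 within {0..})"
  using sol by (auto simp: s_solution_def)

lemma s_solution_eq:
  assumes "0 \<le> t"
  shows "exp t * u x t = u0 x + integral {0..t} (\<lambda>\<tau>. Bop (\<lambda>y. exp \<tau> * u y \<tau>) x)
     + integral {0..t} (\<lambda>\<tau>. exp ((1 - p) * \<tau>) * Bop (\<lambda>y. V y \<tau> * (exp \<tau> * u y \<tau>) powr p) x)"
  using sol assms unfolding s_solution_def by blast

text \<open>By the reverse triangle inequality the norm is continuous in time, hence bounded on
  compact intervals. This starts the halving iteration of the upper comparison.\<close>

lemma s_solution_locally_bounded: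
  "\<exists>M\<ge>0. \<forall>t\<in>{0..T}. \<forall>x. exp t * u x t \<le> M * (1 + norm x) ^ N"
proof -
  define n where "n t = wnorm 1 a (\<lambda>x. exp t * u x t)" for t
  have "continuous_on {0..} n"
    unfolding continuous_on_def
  proof
    fix t0 :: real assume "t0 \<in> {0..}"
    then have t0: "0 \<le> t0" by simp
    have "((\<lambda>t. n t - n t0) \<longlongrightarrow> 0) (at t0 within {0..})"
    proof (rule Lim_null_comparison[OF _ s_solution_continuous[OF t0]])
      have "norm (n t - n t0) \<le> wnorm 1 a (\<lambda>x. exp t * u x t - exp t0 * u x t0)" if t: "0 \<le> t" for t
        using wnorm_le_wnorm_diff[OF s_solution_BC[OF t] s_solution_BC[OF t0]]
          wnorm_le_wnorm_diff[OF s_solution_BC[OF t0] s_solution_BC[OF t]]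
          wnorm_diff_commute[of 1 a "\<lambda>x. exp t * u x t" "\<lambda>x. exp t0 * u x t0"]
        by (simp add: n_def abs_le_iff)
      then show "\<forall>\<^sub>F t in at t0 within {0..}.
          norm (n t - n t0) \<le> wnorm 1 a (\<lambda>x. exp t * u x t - exp t0 * u x t0)"
        by (simp add: eventually_at_filter)
    qed
    then show "(n \<longlongrightarrow> n t0) (at t0 within {0..})"
      by (rule LIM_zero_cancel)
  qed
  then have "bounded (n ` {0..T})"
    by (intro compact_imp_bounded compact_continuous_image) (auto intro: continuous_on_subset)
  then obtain M where M: "\<And>t. t \<in> {0..T} \<Longrightarrow> n t \<le> M"
    unfolding bounded_iff by (metis abs_le_D1 imageI real_norm_def)
  show ?thesis
  proof (intro exI[of _ "max M 0"] conjI ballI allI)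
    fix t x assume t: "t \<in> {0..T}"
    have "exp t * u x t \<le> n t * (1 + norm x) ^ N"
      using BC_abs_le_growth[OF s_solution_BC a, of t x] t by (simp add: n_def)
    also have "\<dots> \<le> max M 0 * (1 + norm x) ^ N"
      using M[OF t] by (intro mult_right_mono) auto
    finally show "exp t * u x t \<le> max M 0 * (1 + norm x) ^ N" .
  qed simp
qed

text \<open>The operator is bounded in the weighted norm, so norm continuity passes to pointwise
  values. The linear term is thereby integrable in time, as the lower comparison requires.\<close>

lemma s_solution_Bop_continuous:
  "continuous_on {0..} (\<lambda>t. Bop (\<lambda>y. exp t * u y t) x)"
  unfolding continuous_on_def
proof
  fix t0 :: real assume "t0 \<in> {0..}"
  then have t0: "0 \<le> t0" by simp
  let ?C = "bessel_growth_const TYPE('a) N * (1 + norm x) ^ N"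
  have "((\<lambda>t. Bop (\<lambda>y. exp t * u y t) x - Bop (\<lambda>y. exp t0 * u y t0) x) \<longlongrightarrow> 0) (at t0 within {0..})"
  proof (rule Lim_null_comparison)
    show "((\<lambda>t. wnorm 1 a (\<lambda>x. exp t * u x t - exp t0 * u x t0) * ?C) \<longlongrightarrow> 0) (at t0 within {0..})"
      using tendsto_mult_right[OF s_solution_continuous[OF t0], of ?C] by simp
    show "\<forall>\<^sub>F t in at t0 within {0..}. norm (Bop (\<lambda>y. exp t * u y t) x - Bop (\<lambda>y. exp t0 * u y t0) x)
        \<le> wnorm 1 a (\<lambda>x. exp t * u x t - exp t0 * u x t0) * ?C"
      using Bop_BC_diff_le[OF s_solution_BC s_solution_BC[OF t0] a]
      by (simp add: eventually_at_filter)
  qed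
  then show "((\<lambda>t. Bop (\<lambda>y. exp t * u y t) x) \<longlongrightarrow> Bop (\<lambda>y. exp t0 * u y t0) x) (at t0 within {0..})"
    by (rule LIM_zero_cancel)
qed

end

section \<open>Comparison with supersolutions and subsolutions\<close>

text \<open>Repeating the step from \<open>M0\<close> gives the constants M0 / 2^n, which tend to 0.
  This plays the role of Gronwall's inequality in both comparisons.\<close>

lemma nonpos_by_halving:
  fixes d w :: "real \<Rightarrow> 'b \<Rightarrow> real"
  assumes M0: "0 \<le> M0" "\<And>t x. t \<in> {0..T} \<Longrightarrow> d t x \<le> M0 * w t x"
    and step: "\<And>M t x. 0 \<le> M \<Longrightarrow> (\<And>t x. t \<in> {0..T} \<Longrightarrow> d t x \<le> M * w t x) \<Longrightarrow>
      t \<in> {0..T} \<Longrightarrow> d t x \<le> M / 2 * w t x"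
    and t: "t \<in> {0..T}"
  shows "d t x \<le> 0"
proof -
  have "\<forall>t\<in>{0..T}. \<forall>x. d t x \<le> M0 / 2 ^ n * w t x" for n
  proof (induction n)
    case (Suc n)
    then show ?case
      using step[of "M0 / 2 ^ n"] M0(1) by (auto simp: mult.commute)
  qed (use M0 in auto)
  then have "d t x \<le> M0 * w t x * (1 / 2) ^ n" for n
    using t by (simp add: power_one_over)
  moreover have "(\<lambda>n. M0 * w t x * (1 / 2) ^ n) \<longlonglongrightarrow> M0 * w t x * 0"
    by (intro tendsto_mult_left LIMSEQ_power_zero) auto
  ultimately show ?thesis
    by (intro LIMSEQ_le_const) auto
qed

text \<open>The Henstock--Kurzweil integral of a non-integrable function is 0, so no integrability
  of the summands is needed.\<close>
lemma integral_add_le_bound: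
  fixes f g G :: "real \<Rightarrow> real"
  assumes nn: "\<And>t. t \<in> S \<Longrightarrow> 0 \<le> f t" "\<And>t. t \<in> S \<Longrightarrow> 0 \<le> g t"
    and le: "\<And>t. t \<in> S \<Longrightarrow> f t + g t \<le> G t" and G: "(G has_integral I) S"
  shows "integral S f + integral S g \<le> I"
proof -
  have fG: "f t \<le> G t" and gG: "g t \<le> G t" and G0: "0 \<le> G t" if "t \<in> S" for t
    using nn[OF that] le[OF that] by auto
  have I: "0 \<le> I" using G G0 by (rule has_integral_nonneg)
  consider "f integrable_on S" "g integrable_on S" | "\<not> f integrable_on S" | "\<not> g integrable_on S"
    by blast
  then show ?thesis
  proof cases
    case 1
    then have "((\<lambda>t. f t + g t) has_integral (integral S f + integral S g)) S"
      by (intro has_integral_add integrable_integral)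
    then show ?thesis using G le by (rule has_integral_le)
  next
    case 2
    then have "integral S f = 0" by (rule not_integrable_integral)
    moreover have "integral S g \<le> I"
      using has_integral_le[OF integrable_integral G gG] I
      by (cases "g integrable_on S") (auto simp: not_integrable_integral)
    ultimately show ?thesis by simp
  next
    case 3
    then have "integral S g = 0" by (rule not_integrable_integral)
    moreover have "integral S f \<le> I"
      using has_integral_le[OF integrable_integral G fG] I
      by (cases "f integrable_on S") (auto simp: not_integrable_integral)
    ultimately show ?thesis by simp
  qed
qed

lemma has_integral_exp_scale:
  fixes l t :: real
  assumes "0 < l" "0 \<le> t"
  shows "((\<lambda>s. exp (l * s)) has_integral (exp (l * t) - 1) / l) {0..t}"
proof -
  have "((\<lambda>s. exp (l * s)) has_integral (exp (l * t) / l - exp (l * 0) / l)) {0..t}"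
    using assms by (intro fundamental_theorem_of_calculus)
      (auto intro!: derivative_eq_intros simp: has_real_derivative_iff_has_vector_derivative[symmetric])
  then show ?thesis by (simp add: diff_divide_distrib)
qed

text \<open>\<open>Vw\<close> bounds the sublinear term by the linear one with coefficient
  \<open>q\<close>, because p < 1 and the competitor lies above w. The excess over w then obeys a
  linear integral inequality, which the halving iteration closes.\<close>

lemma s_solution_le_supersolution:
  fixes u0 :: "'a::euclidean_space \<Rightarrow> real" and w w' :: "real \<Rightarrow> 'a \<Rightarrow> real" and q :: "real \<Rightarrow> real"
  assumes sol: "s_solution p V a u0 u" and a: "0 \<le> a" "a \<le> real N"
    and p: "0 < p" "p < 1"
    and V: "\<And>x t. 0 \<le> t \<Longrightarrow> 0 \<le> V x t"
    and w_pos: "\<And>x t. 0 \<le> t \<Longrightarrow> 0 < w t x"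
    and w_growth: "\<And>t. 0 \<le> t \<Longrightarrow> poly_growth N (w t)"
    and q: "\<And>t. 0 \<le> t \<Longrightarrow> 0 \<le> q t" "\<And>t. 0 \<le> t \<Longrightarrow> q t \<le> Q"
    and Vw: "\<And>x t. 0 \<le> t \<Longrightarrow> exp ((1 - p) * t) * V x t * w t x powr (p - 1) \<le> q t"
    and w0: "\<And>x. u0 x \<le> w 0 x"
    and w_deriv: "\<And>x t. 0 \<le> t \<Longrightarrow> ((\<lambda>t. w t x) has_real_derivative w' t x) (at t within {0..})"
    and w_super: "\<And>x t. 0 \<le> t \<Longrightarrow> (1 + q t) * Bop (w t) x \<le> w' t x"
    and t: "0 \<le> t"
  shows "exp t * u x t \<le> w t x"
proof -
  define C where "C = bessel_growth_const TYPE('a) N"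
  \<comment> \<open>Twice the growth factor of the linearised operator on the weight: integrating
    exp(L r) gains 1/L, which halves the constant M.\<close>
  define L where "L = 2 * ((1 + Q) * C)"
  define \<mu> where "\<mu> t x = exp t * u x t" for t x
  have C: "1 \<le> C" unfolding C_def by (rule bessel_growth_const_ge_1)
  have Q: "0 \<le> Q" using q[of 0] by auto
  have L: "0 < L" using C Q by (auto simp: L_def)
  obtain M0 where M0: "0 \<le> M0" "\<And>s x. s \<in> {0..t} \<Longrightarrow> \<mu> s x \<le> M0 * (1 + norm x) ^ N"
    using s_solution_locally_bounded[OF sol a, of t] by (auto simp: \<mu>_def)
  define W where "W s x = exp (L * s) * (1 + norm x) ^ N" for s and x :: 'a
  have "\<mu> t x - w t x \<le> 0"
  proof (rule nonpos_by_halving[where w = W and d = "\<lambda>t x. \<mu> t x - w t x" and T = t and ?M0.0 = M0])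
    fix s x assume s: "s \<in> {0..t}"
    have "\<mu> s x - w s x \<le> M0 * (1 + norm x) ^ N"
      using M0(2)[OF s, of x] w_pos[of s x] s by auto
    also have "\<dots> \<le> M0 * W s x"
      using M0(1) L s mult_right_mono[of 1 "exp (L * s)" "(1 + norm x) ^ N"]
      by (auto simp: W_def intro!: mult_left_mono)
    finally show "\<mu> s x - w s x \<le> M0 * W s x" .
  next
    fix M s x
    assume M: "0 \<le> M" and le: "\<And>s x. s \<in> {0..t} \<Longrightarrow> \<mu> s x - w s x \<le> M * W s x" and s: "s \<in> {0..t}"
    have bound: "Bop (\<mu> r) x + exp ((1 - p) * r) * Bop (\<lambda>y. V y r * \<mu> r y powr p) x \<le>
        w' r x + (1 + Q) * C * M * (1 + norm x) ^ N * exp (L * r)" if r: "r \<in> {0..s}" for r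
    proof -
      have r0: "0 \<le> r" and rt: "r \<in> {0..t}" using r s by auto
      have W0: "0 \<le> M * W r y" for y using M by (simp add: W_def)
      have WG: "poly_growth N (\<lambda>y. M * W r y)"
        unfolding W_def by (intro poly_growth_cmult poly_growth_power order_refl)
      have G: "poly_growth N (\<lambda>y. w r y + M * W r y)"
        by (intro poly_growth_add w_growth r0 WG)
      have \<mu>le: "\<mu> r y \<le> w r y + M * W r y" for y using le[OF rt, of y] by simp
      have nn: "0 \<le> w r y + M * W r y" for y using w_pos[OF r0, of y] W0[of y] by simp
      have 1: "Bop (\<mu> r) x \<le> Bop (\<lambda>y. w r y + M * W r y) x"
        using \<mu>le nn by (rule Bop_mono[OF G])
      have "exp ((1 - p) * r) * Bop (\<lambda>y. V y r * \<mu> r y powr p) x =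
          Bop (\<lambda>y. exp ((1 - p) * r) * (V y r * \<mu> r y powr p)) x"
        by (simp add: Bop_cmult)
      also have "\<dots> \<le> Bop (\<lambda>y. q r * (w r y + M * W r y)) x"
      proof (rule Bop_mono[OF poly_growth_cmult[OF G]])
        fix y
        let ?v = "w r y + M * W r y"
        have v: "0 < ?v" using w_pos[OF r0, of y] W0[of y] by simp
        have "\<mu> r y powr p \<le> ?v powr p"
          using \<mu>le[of y] p s_solution_nonneg[OF sol a r0] by (intro powr_mono2) (auto simp: \<mu>_def)
        also have "\<dots> = ?v powr (p - 1) * ?v"
          using v by (simp add: powr_diff)
        \<comment> \<open>The exponent p - 1 is negative and \<open>?v\<close> lies above w, so the
          coefficient can be evaluated at w.\<close>
        also have "\<dots> \<le> w r y powr (p - 1) * ?v"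
          using v w_pos[OF r0, of y] W0[of y] p by (intro mult_right_mono powr_mono2') auto
        finally have "(exp ((1 - p) * r) * V y r) * \<mu> r y powr p \<le>
            (exp ((1 - p) * r) * V y r) * (w r y powr (p - 1) * ?v)"
          using V[OF r0] by (intro mult_left_mono) auto
        also have "\<dots> = (exp ((1 - p) * r) * V y r * w r y powr (p - 1)) * ?v" by simp
        also have "\<dots> \<le> q r * ?v" using Vw[OF r0] v by (intro mult_right_mono) auto
        finally show "exp ((1 - p) * r) * (V y r * \<mu> r y powr p) \<le> q r * ?v" by simp
        show "0 \<le> q r * ?v" using v q[OF r0] by simp
      qed
      also have "\<dots> = q r * Bop (\<lambda>y. w r y + M * W r y) x" by (rule Bop_cmult)
      finally have 2: "exp ((1 - p) * r) * Bop (\<lambda>y. V y r * \<mu> r y powr p) x \<le>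
          q r * Bop (\<lambda>y. w r y + M * W r y) x" .
      have "Bop (\<lambda>y. w r y + M * W r y) x = Bop (w r) x + M * exp (L * r) * Bop (\<lambda>y. (1 + norm y) ^ N) x"
        by (subst Bop_add[OF w_growth[OF r0] WG]) (simp add: W_def Bop_cmult mult.assoc)
      also have "\<dots> \<le> Bop (w r) x + M * exp (L * r) * (C * (1 + norm x) ^ N)"
        unfolding C_def using M by (intro add_left_mono mult_left_mono Bop_power_le) auto
      finally have 3: "Bop (\<lambda>y. w r y + M * W r y) x \<le> Bop (w r) x + C * M * (1 + norm x) ^ N * exp (L * r)"
        by (simp add: mult_ac)
      have "Bop (\<mu> r) x + exp ((1 - p) * r) * Bop (\<lambda>y. V y r * \<mu> r y powr p) x \<le>
          (1 + q r) * Bop (\<lambda>y. w r y + M * W r y) x"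
        using 1 2 by (simp add: distrib_right)
      also have "\<dots> \<le> (1 + q r) * (Bop (w r) x + C * M * (1 + norm x) ^ N * exp (L * r))"
        using q[OF r0] by (intro mult_left_mono 3) auto
      also have "\<dots> = (1 + q r) * Bop (w r) x + (1 + q r) * (C * M * (1 + norm x) ^ N * exp (L * r))"
        by (rule distrib_left)
      also have "\<dots> \<le> w' r x + (1 + Q) * (C * M * (1 + norm x) ^ N * exp (L * r))"
        using q[OF r0] M C by (intro add_mono w_super r0 mult_right_mono) auto
      finally show ?thesis by (simp add: mult.assoc)
    qed
    have int: "((\<lambda>r. w' r x + (1 + Q) * C * M * (1 + norm x) ^ N * exp (L * r)) has_integral
        (w s x - w 0 x + (1 + Q) * C * M * (1 + norm x) ^ N * ((exp (L * s) - 1) / L))) {0..s}"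
    proof (intro has_integral_add has_integral_mult_right has_integral_exp_scale L)
      show "((\<lambda>r. w' r x) has_integral (w s x - w 0 x)) {0..s}"
        using s by (intro fundamental_theorem_of_calculus)
          (auto simp: has_real_derivative_iff_has_vector_derivative[symmetric]
            intro: has_field_derivative_subset[OF w_deriv])
    qed (use s in auto)
    \<comment> \<open>The two integrals are estimated together: \<open>bound\<close> controls the
      sum of the integrands, and the nonlinear one is not known to be integrable in time.\<close>
    have "integral {0..s} (\<lambda>r. Bop (\<mu> r) x) +
        integral {0..s} (\<lambda>r. exp ((1 - p) * r) * Bop (\<lambda>y. V y r * \<mu> r y powr p) x) \<le>
        w s x - w 0 x + (1 + Q) * C * M * (1 + norm x) ^ N * ((exp (L * s) - 1) / L)"
      using bound s_solution_nonneg[OF sol a] V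
      by (intro integral_add_le_bound[OF _ _ _ int]) (auto simp: \<mu>_def intro!: Bop_nonneg mult_nonneg_nonneg)
    moreover have "\<mu> s x = u0 x + integral {0..s} (\<lambda>r. Bop (\<mu> r) x) +
        integral {0..s} (\<lambda>r. exp ((1 - p) * r) * Bop (\<lambda>y. V y r * \<mu> r y powr p) x)"
      unfolding \<mu>_def using s_solution_eq[OF sol a, of s x] s by simp
    ultimately have "\<mu> s x - w s x \<le> (1 + Q) * C * M * (1 + norm x) ^ N * ((exp (L * s) - 1) / L)"
      using w0[of x] by linarith
    also have "\<dots> \<le> (1 + Q) * C * M * (1 + norm x) ^ N * (exp (L * s) / L)"
      using Q C M L by (intro mult_left_mono divide_right_mono) auto
    also have "\<dots> = M / 2 * W s x"
      using L C Q by (simp add: W_def L_def field_simps)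
    finally show "\<mu> s x - w s x \<le> M / 2 * W s x" .
  qed (use t M0 in auto)
  then show ?thesis by (simp add: \<mu>_def)
qed

text \<open>The nonlinear term is nonnegative and is dropped, so comparison with the linear flow
  suffices.\<close>

lemma s_solution_ge_subsolution:
  fixes u0 :: "'a::euclidean_space \<Rightarrow> real" and w w' :: "real \<Rightarrow> 'a \<Rightarrow> real"
  assumes sol: "s_solution p V a u0 u" and a: "0 \<le> a" "a \<le> real N"
    and V: "\<And>x t. 0 \<le> t \<Longrightarrow> 0 \<le> V x t"
    and w_growth: "\<And>t. 0 \<le> t \<Longrightarrow> poly_growth N (w t)"
    and w_le: "0 \<le> M0" "\<And>t x. t \<in> {0..T} \<Longrightarrow> w t x \<le> M0 * (1 + norm x) ^ N"
    and w0: "\<And>x. w 0 x \<le> u0 x"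
    and w_deriv: "\<And>x t. 0 \<le> t \<Longrightarrow> ((\<lambda>t. w t x) has_real_derivative w' t x) (at t within {0..})"
    and w_sub: "\<And>x t. 0 \<le> t \<Longrightarrow> w' t x \<le> Bop (w t) x"
    and T: "0 \<le> T"
  shows "w T x \<le> exp T * u x T"
proof -
  define C where "C = bessel_growth_const TYPE('a) N"
  define L where "L = 2 * C"
  define \<mu> where "\<mu> t x = exp t * u x t" for t x
  have C: "1 \<le> C" unfolding C_def by (rule bessel_growth_const_ge_1)
  have L: "0 < L" using C by (auto simp: L_def)
  have \<mu>0: "0 \<le> \<mu> t x" if "0 \<le> t" for t x
    using s_solution_nonneg[OF sol a that] by (simp add: \<mu>_def)
  define W where "W s x = exp (L * s) * (1 + norm x) ^ N" for s and x :: 'a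
  have "w T x - \<mu> T x \<le> 0"
  proof (rule nonpos_by_halving[where w = W and d = "\<lambda>t x. w t x - \<mu> t x" and T = T and ?M0.0 = M0])
    fix s x assume s: "s \<in> {0..T}"
    have "w s x - \<mu> s x \<le> M0 * (1 + norm x) ^ N"
      using w_le(2)[OF s, of x] \<mu>0[of s x] s by auto
    also have "\<dots> \<le> M0 * W s x"
      using w_le(1) L s mult_right_mono[of 1 "exp (L * s)" "(1 + norm x) ^ N"]
      by (auto simp: W_def intro!: mult_left_mono)
    finally show "w s x - \<mu> s x \<le> M0 * W s x" .
  next
    fix M s x
    assume M: "0 \<le> M" and le: "\<And>s x. s \<in> {0..T} \<Longrightarrow> w s x - \<mu> s x \<le> M * W s x" and s: "s \<in> {0..T}"
    have bound: "w' r x - C * M * (1 + norm x) ^ N * exp (L * r) \<le> Bop (\<mu> r) x" if r: "r \<in> {0..s}" for r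
    proof -
      have r0: "0 \<le> r" and rt: "r \<in> {0..T}" using r s by auto
      have WG: "poly_growth N (\<lambda>y. M * W r y)"
        unfolding W_def by (intro poly_growth_cmult poly_growth_power order_refl)
      have \<mu>G: "poly_growth N (\<mu> r)"
        using BC_poly_growth[OF s_solution_BC[OF sol a r0] a] by (simp add: \<mu>_def[abs_def])
      have "w' r x \<le> Bop (w r) x" by (rule w_sub[OF r0])
      also have "\<dots> \<le> Bop (\<lambda>y. \<mu> r y + M * W r y) x"
      proof (rule Bop_mono_growth[OF w_growth[OF r0] poly_growth_add[OF \<mu>G WG]])
        show "w r y \<le> \<mu> r y + M * W r y" for y using le[OF rt, of y] by simp
      qed
      also have "\<dots> = Bop (\<mu> r) x + M * exp (L * r) * Bop (\<lambda>y. (1 + norm y) ^ N) x"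
        by (subst Bop_add[OF \<mu>G WG]) (simp add: W_def Bop_cmult mult.assoc)
      also have "\<dots> \<le> Bop (\<mu> r) x + M * exp (L * r) * (C * (1 + norm x) ^ N)"
        unfolding C_def using M by (intro add_left_mono mult_left_mono Bop_power_le) auto
      finally show ?thesis by (simp add: mult_ac)
    qed
    have int: "((\<lambda>r. w' r x - C * M * (1 + norm x) ^ N * exp (L * r)) has_integral
        (w s x - w 0 x - C * M * (1 + norm x) ^ N * ((exp (L * s) - 1) / L))) {0..s}"
    proof (intro has_integral_diff has_integral_mult_right has_integral_exp_scale L)
      show "((\<lambda>r. w' r x) has_integral (w s x - w 0 x)) {0..s}"
        using s by (intro fundamental_theorem_of_calculus)
          (auto simp: has_real_derivative_iff_has_vector_derivative[symmetric]
            intro: has_field_derivative_subset[OF w_deriv])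
    qed (use s in auto)
    \<comment> \<open>A lower bound on this integral needs genuine integrability, as the default
      value 0 could violate it.\<close>
    have "(\<lambda>r. Bop (\<mu> r) x) integrable_on {0..s}"
      unfolding \<mu>_def
      by (intro integrable_continuous_interval continuous_on_subset[OF s_solution_Bop_continuous[OF sol a]]) auto
    then have "w s x - w 0 x - C * M * (1 + norm x) ^ N * ((exp (L * s) - 1) / L) \<le>
        integral {0..s} (\<lambda>r. Bop (\<mu> r) x)"
      using bound by (intro has_integral_le[OF int integrable_integral]) auto
    \<comment> \<open>Here the default value 0 of a non-integrable function is compatible with the
      claim.\<close>
    moreover have "0 \<le> integral {0..s} (\<lambda>r. exp ((1 - p) * r) * Bop (\<lambda>y. V y r * \<mu> r y powr p) x)"
      using V by (cases "(\<lambda>r. exp ((1 - p) * r) * Bop (\<lambda>y. V y r * \<mu> r y powr p) x) integrable_on {0..s}")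
        (auto simp: not_integrable_integral intro!: Henstock_Kurzweil_Integration.integral_nonneg Bop_nonneg mult_nonneg_nonneg)
    moreover have "\<mu> s x = u0 x + integral {0..s} (\<lambda>r. Bop (\<mu> r) x) +
        integral {0..s} (\<lambda>r. exp ((1 - p) * r) * Bop (\<lambda>y. V y r * \<mu> r y powr p) x)"
      unfolding \<mu>_def using s_solution_eq[OF sol a, of s x] s by simp
    ultimately have "w s x - \<mu> s x \<le> C * M * (1 + norm x) ^ N * ((exp (L * s) - 1) / L)"
      using w0[of x] by linarith
    also have "\<dots> \<le> C * M * (1 + norm x) ^ N * (exp (L * s) / L)"
      using C M L by (intro mult_left_mono divide_right_mono) auto
    also have "\<dots> = M / 2 * W s x"
      using L C by (simp add: W_def L_def field_simps)
    finally show "w s x - \<mu> s x \<le> M / 2 * W s x" .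
  qed (use T w_le in auto)
  then show ?thesis by (simp add: \<mu>_def)
qed

section \<open>Growth rates\<close>

lemma moving_weight_deriv:
  assumes "0 \<le> k" "0 \<le> t"
  shows "((\<lambda>t. moving_weight b k t x) has_real_derivative b * k * moving_weight (b - 1) k t x) (at t within S)"
proof -
  have "0 < 1 + k * t + (norm x)\<^sup>2"
    using assms by (intro add_pos_nonneg) auto
  then show ?thesis
    unfolding moving_weight_def by (auto intro!: derivative_eq_intros)
qed

text \<open>Continuity bounds the function on a compact interval and the limit takes over beyond it;
  the maximum with 1 lets one constant serve both ranges.\<close>

lemma subpolynomial_bound:
  fixes \<zeta> :: "real \<Rightarrow> real"
  assumes cont: "continuous_on {0..} \<zeta>" and \<eta>: "0 < \<eta>"
    and lim: "((\<lambda>t. t powr (-\<eta>) * \<zeta> t) \<longlongrightarrow> 0) at_top"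
  shows "\<exists>C>0. \<forall>t\<ge>0. \<zeta> t \<le> C * (1 + t) powr \<eta>"
proof -
  have "\<forall>\<^sub>F t in at_top. t powr (-\<eta>) * \<zeta> t < 1"
    using lim by (rule order_tendstoD) simp
  then obtain T0 where T0: "\<And>t. T0 \<le> t \<Longrightarrow> t powr (-\<eta>) * \<zeta> t < 1"
    by (auto simp: eventually_at_top_linorder)
  define T where "T = max T0 1"
  have "bounded (\<zeta> ` {0..T})"
    by (intro compact_imp_bounded compact_continuous_image continuous_on_subset[OF cont]) auto
  then obtain B where B: "\<And>t. t \<in> {0..T} \<Longrightarrow> \<zeta> t \<le> B"
    unfolding bounded_iff by (metis abs_le_D1 imageI real_norm_def)
  show ?thesis
  proof (intro exI[of _ "max B 1"] conjI allI impI)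
    fix t :: real assume t: "0 \<le> t"
    have ge1: "1 \<le> (1 + t) powr \<eta>" using t \<eta> by (simp add: ge_one_powr_ge_zero)
    show "\<zeta> t \<le> max B 1 * (1 + t) powr \<eta>"
    proof (cases "t \<le> T")
      case True
      then have "\<zeta> t \<le> max B 1 * 1" using B[of t] t by simp
      also have "\<dots> \<le> max B 1 * (1 + t) powr \<eta>" using ge1 by (intro mult_left_mono) auto
      finally show ?thesis .
    next
      case False
      then have t1: "T0 \<le> t" "0 < t" by (auto simp: T_def)
      have "\<zeta> t = t powr \<eta> * (t powr (-\<eta>) * \<zeta> t)" using t1 by (simp add: powr_minus)
      also have "\<dots> \<le> t powr \<eta> * 1" using T0[OF t1(1)] by (intro mult_left_mono) auto
      also have "\<dots> \<le> (1 + t) powr \<eta>" using t1 \<eta> by (simp add: powr_mono2)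
      also have "\<dots> \<le> max B 1 * (1 + t) powr \<eta>" using ge1 by (simp add: mult_le_cancel_right1)
      finally show ?thesis .
    qed
  qed simp
qed

lemma npow_le_powr_half:
  assumes "0 \<le> r" "0 \<le> s" "r\<^sup>2 \<le> y" "1 \<le> y"
  shows "npow r s \<le> y powr (s / 2)"
proof (cases "s = 0 \<or> r = 0")
  case True
  then show ?thesis using assms by (auto simp: npow_def)
next
  case False
  then have "npow r s = (r\<^sup>2) powr (s / 2)"
    using assms powr_powr[of r 2 "s / 2"] by (simp add: npow_def)
  also have "\<dots> \<le> y powr (s / 2)" using assms by (intro powr_mono2) auto
  finally show ?thesis .
qed

lemma npow_nonneg: "0 \<le> npow r s"
  by (simp add: npow_def)

text \<open>The condition \<open>a > a\<^sub>c\<close> enters only here: it makes the potential, seen by the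
  moving weight, integrable in time.\<close>
lemma potential_moving_weight_decay:
  fixes x :: "'a::euclidean_space"
  assumes \<zeta>: "\<And>t. 0 \<le> t \<Longrightarrow> \<zeta> t \<le> C * (1 + t) powr \<eta>" and C: "0 < C"
    and \<sigma>: "0 \<le> \<sigma>" and p: "p < 1" and k: "1 \<le> k" and t: "0 \<le> t"
    and \<eta>: "0 < \<eta>" "4 * \<eta> = a * (1 - p) - \<sigma> - 2 * (\<nu> + 1)" and a: "\<sigma> \<le> a * (1 - p)"
  shows "\<zeta> t * (1 + t) powr \<nu> * npow (norm x) \<sigma> * moving_weight (a / 2) k t x powr (p - 1)
    \<le> C * (1 + t) powr (- \<eta> - 1)"
proof -
  define s where "s = 1 + k * t + (norm x)\<^sup>2"
  have kt: "t \<le> k * t" using k t by (simp add: mult_le_cancel_right1)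
  have s: "1 + t \<le> s" "1 \<le> s" "(norm x)\<^sup>2 \<le> s" using kt t zero_le_power2[of "norm x"] unfolding s_def by linarith+
  have "npow (norm x) \<sigma> * moving_weight (a / 2) k t x powr (p - 1) \<le> s powr (\<sigma> / 2) * s powr (a / 2 * (p - 1))"
    using s \<sigma> by (auto simp: moving_weight_def s_def[symmetric] powr_powr intro!: mult_right_mono npow_le_powr_half)
  also have "\<dots> = s powr (\<sigma> / 2 + a / 2 * (p - 1))" by (simp add: powr_add)
  \<comment> \<open>By assumption \<open>a\<close> the exponent is not positive, so s may be
    replaced by the smaller 1 + t.\<close>
  also have "\<dots> \<le> (1 + t) powr (\<sigma> / 2 + a / 2 * (p - 1))"
    using s t a by (intro powr_mono2') (auto simp: field_simps)
  finally have 1: "npow (norm x) \<sigma> * moving_weight (a / 2) k t x powr (p - 1) \<le>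
      (1 + t) powr (\<sigma> / 2 + a / 2 * (p - 1))" .
  have "(\<zeta> t * (1 + t) powr \<nu>) * (npow (norm x) \<sigma> * moving_weight (a / 2) k t x powr (p - 1)) \<le>
      (C * (1 + t) powr \<eta> * (1 + t) powr \<nu>) * (1 + t) powr (\<sigma> / 2 + a / 2 * (p - 1))"
    using \<zeta>[OF t] C by (intro mult_mono 1 mult_right_mono) (auto simp: npow_nonneg)
  also have "\<dots> = C * (1 + t) powr (\<eta> + \<nu> + (\<sigma> / 2 + a / 2 * (p - 1)))"
    by (simp add: powr_add)
  also have "\<eta> + \<nu> + (\<sigma> / 2 + a / 2 * (p - 1)) = - \<eta> - 1"
    using \<eta> by (simp add: field_simps)
  finally show ?thesis by (simp add: mult.assoc)
qed

lemma s_solution_upper_bound: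
  fixes u0 :: "'a::euclidean_space \<Rightarrow> real"
  assumes p: "0 < p" "p < 1" and \<sigma>: "0 \<le> \<sigma>"
    and \<zeta>_cont: "continuous_on {0..} \<zeta>"
    and \<zeta>_pos: "\<And>t. 0 \<le> t \<Longrightarrow> 0 < \<zeta> t"
    and \<zeta>_lim: "\<And>\<delta>. 0 < \<delta> \<Longrightarrow> ((\<lambda>t. t powr (-\<delta>) * \<zeta> t) \<longlongrightarrow> 0) at_top"
    and a: "(\<sigma> + 2 * max (\<nu> + 1) 0) / (1 - p) < a"
    and sol: "s_solution p (\<lambda>x t. \<zeta> t * (1 + t) powr \<nu> * npow (norm x) \<sigma>) a u0 u"
  shows "\<exists>C k. 0 < C \<and> 1 \<le> k \<and> (\<forall>t\<ge>0. \<forall>x. u x t \<le> C * moving_weight (a / 2) k t x)"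
proof -
  have ap: "\<sigma> + 2 * max (\<nu> + 1) 0 < a * (1 - p)"
    using a p by (simp add: pos_divide_less_eq)
  have a0: "0 < a"
  proof -
    have "0 \<le> \<sigma> + 2 * max (\<nu> + 1) 0" using \<sigma> by (intro add_nonneg_nonneg) auto
    from this ap have "0 < a * (1 - p)" by (rule le_less_trans)
    then show ?thesis using p by (simp add: zero_less_mult_iff)
  qed
  obtain N :: nat where N: "a \<le> real N" using real_arch_simple by blast
  \<comment> \<open>A quarter of the gap left by a > a_c: in the total exponent -2\<eta> - 1
    appears, one \<eta> pays for \<zeta>, and the other keeps the decay integrable.\<close>
  define \<eta> where "\<eta> = (a * (1 - p) - \<sigma> - 2 * (\<nu> + 1)) / 4"
  have "\<sigma> + 2 * (\<nu> + 1) \<le> \<sigma> + 2 * max (\<nu> + 1) 0"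
    by (intro add_left_mono mult_left_mono) auto
  from this ap have "\<sigma> + 2 * (\<nu> + 1) < a * (1 - p)" by (rule le_less_trans)
  then have \<eta>: "0 < \<eta>" by (simp add: \<eta>_def)
  obtain Q where Q: "0 < Q" "\<And>t. 0 \<le> t \<Longrightarrow> \<zeta> t \<le> Q * (1 + t) powr \<eta>"
    using subpolynomial_bound[OF \<zeta>_cont \<eta> \<zeta>_lim[OF \<eta>]] by blast
  obtain k where k: "1 \<le> k" and Bk: "\<And>t (x::'a). 0 \<le> t \<Longrightarrow>
      Bop (moving_weight (a / 2) k t) x \<le> moving_weight (a / 2) k t x + a / 2 * k * moving_weight (a / 2 - 1) k t x"
    using Bop_moving_weight_le[of "a / 2", where 'a='a] a0 by auto
  define z where "z = (moving_weight (a / 2) k :: real \<Rightarrow> 'a \<Rightarrow> real)"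
  define z' where "z' t x = a / 2 * k * moving_weight (a / 2 - 1) k t x" for t and x :: 'a
  \<comment> \<open>Bounds (z + z') / z, because lowering the exponent by one does not increase a
    power with base at least 1.\<close>
  define c where "c = 1 + a / 2 * k"
  have c: "0 < c" using a0 k by (simp add: c_def add_pos_nonneg)
  have base: "1 \<le> 1 + k * t + (norm x)\<^sup>2" if "0 \<le> t" for t and x :: 'a
    using k that by simp
  have z1: "1 \<le> z t x" if "0 \<le> t" for t x
    unfolding z_def moving_weight_def using base[OF that, of x] a0 by (intro ge_one_powr_ge_zero) auto
  have Bz: "Bop (z t) x \<le> z t x + z' t x" if "0 \<le> t" for t x
    using Bk[OF that] by (simp add: z_def z'_def)
  have z'z: "z t x + z' t x \<le> c * z t x" if "0 \<le> t" for t x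
  proof -
    have "moving_weight (a / 2 - 1) k t x \<le> z t x"
      unfolding z_def moving_weight_def using base[OF that, of x] by (intro powr_mono) auto
    then have "a / 2 * k * moving_weight (a / 2 - 1) k t x \<le> a / 2 * k * z t x"
      using a0 k by (intro mult_left_mono) auto
    then show ?thesis by (simp add: z'_def c_def distrib_right)
  qed
  define q where "q t = Q * (1 + t) powr (- \<eta> - 1)" for t :: real
  have q: "0 \<le> q t" "q t \<le> Q" if "0 \<le> t" for t
  proof -
    have "(1 + t) powr (- \<eta> - 1) \<le> (1 + t) powr 0"
      using that \<eta> by (intro powr_mono) auto
    then show "0 \<le> q t" "q t \<le> Q"
      using Q that mult_left_mono[of "(1 + t) powr (- \<eta> - 1)" 1 Q] by (auto simp: q_def)
  qed
  \<comment> \<open>The solution of g' = c q g with g(0) = 1, namely the exponential of c times the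
    integral of q; integrability of q keeps it bounded.\<close>
  define g where "g t = exp (c * Q / \<eta> * (1 - (1 + t) powr (- \<eta>)))" for t :: real
  have g_deriv: "(g has_real_derivative c * q t * g t) (at t within {0..})" if "0 \<le> t" for t
    unfolding g_def[abs_def] q_def using that \<eta>
    by (auto intro!: derivative_eq_intros simp: field_simps)
  have g1: "1 \<le> g t" if "0 \<le> t" for t
  proof -
    have "(1 + t) powr (- \<eta>) \<le> (1 + t) powr 0"
      using that \<eta> by (intro powr_mono) auto
    then show ?thesis
      unfolding g_def using that \<eta> c Q by simp
  qed
  have gG: "g t \<le> exp (c * Q / \<eta>)" if "0 \<le> t" for t
    unfolding g_def using \<eta> c Q(1) mult_left_mono[of "1 - (1 + t) powr (- \<eta>)" 1 "c * Q / \<eta>"] by simp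
  have B0: "(\<lambda>x. exp 0 * u x 0) \<in> BC a" using sol by (auto simp: s_solution_def)
  \<comment> \<open>The norm makes the barrier dominate the initial datum; the maximum with 1 keeps
    w above exp(t) z.\<close>
  define A where "A = max 1 (wnorm 1 a (\<lambda>x. exp 0 * u x 0))"
  have A: "1 \<le> A" by (simp add: A_def)
  define w where "w t x = A * (exp t * (g t * z t x))" for t x
  define w' where "w' t x = A * (exp t * (g t * z t x) + exp t * (c * q t * g t * z t x + g t * z' t x))" for t x
  have "exp t * u x t \<le> w t x" if "0 \<le> t" for t x
  proof (rule s_solution_le_supersolution[OF sol _ N p, where w = w and w' = w' and q = q and Q = Q])
    fix t :: real and x :: 'a assume t: "0 \<le> t"
    have pos: "0 < g t * z t x" "0 < z t x" using g1[OF t] z1[OF t, of x] by auto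
    show "0 < w t x" using A pos by (simp add: w_def)
    show "0 \<le> \<zeta> t * (1 + t) powr \<nu> * npow (norm x) \<sigma>"
      using \<zeta>_pos[OF t] by (simp add: npow_nonneg)
    show "poly_growth N (w t)"
      unfolding w_def z_def using a0 k N t by (intro poly_growth_cmult poly_growth_moving_weight) auto
    show "0 \<le> q t" "q t \<le> Q" using q[OF t] by auto
    show "((\<lambda>t. w t x) has_real_derivative w' t x) (at t within {0..})"
      unfolding w_def w'_def using g_deriv[OF t] moving_weight_deriv[of k t "a / 2" x "{0..}"] k t
      unfolding z_def z'_def
      by (auto intro!: derivative_eq_intros simp: algebra_simps)
    show "(1 + q t) * Bop (w t) x \<le> w' t x"
    proof -
      have Bw: "Bop (w t) x = A * exp t * g t * Bop (z t) x"
        unfolding w_def by (simp add: Bop_cmult mult.assoc)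
      \<comment> \<open>The first copy of B z is absorbed by the growth of exp(t) z, the second,
        coming from the potential, by g' = c q g.\<close>
      have "Bop (z t) x + q t * Bop (z t) x \<le> (z t x + z' t x) + q t * (c * z t x)"
        using Bz[OF t] order_trans[OF Bz[OF t] z'z[OF t]] q[OF t] by (intro add_mono mult_left_mono) auto
      then have "A * exp t * g t * (Bop (z t) x + q t * Bop (z t) x) \<le>
          A * exp t * g t * ((z t x + z' t x) + q t * (c * z t x))"
        using A g1[OF t] by (intro mult_left_mono) auto
      then show ?thesis by (simp add: Bw w'_def algebra_simps)
    qed
    show "exp ((1 - p) * t) * (\<zeta> t * (1 + t) powr \<nu> * npow (norm x) \<sigma>) * w t x powr (p - 1) \<le> q t"
    proof -
      \<comment> \<open>Uses A, g >= 1. The negative power p - 1 reverses the inequality, and its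
        factor exp(-(1-p)t) cancels the exponential of the integral equation.\<close>
      have "exp t * z t x \<le> w t x"
        using mult_mono[OF A g1[OF t]] A pos by (simp add: w_def mult_ac mult_le_cancel_right1)
      then have "w t x powr (p - 1) \<le> (exp t * z t x) powr (p - 1)"
        using pos p by (intro powr_mono2') auto
      also have "\<dots> = exp (- ((1 - p) * t)) * z t x powr (p - 1)"
        using pos by (simp add: powr_mult exp_powr_real algebra_simps)
      finally have "exp ((1 - p) * t) * (\<zeta> t * (1 + t) powr \<nu> * npow (norm x) \<sigma>) * w t x powr (p - 1) \<le>
          exp ((1 - p) * t) * (\<zeta> t * (1 + t) powr \<nu> * npow (norm x) \<sigma>) *
            (exp (- ((1 - p) * t)) * z t x powr (p - 1))"
        using \<zeta>_pos[OF t] by (intro mult_left_mono) (auto simp: npow_nonneg)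
      also have "\<dots> = exp ((1 - p) * t) * exp (- ((1 - p) * t)) *
          (\<zeta> t * (1 + t) powr \<nu> * npow (norm x) \<sigma> * z t x powr (p - 1))"
        by (simp only: mult_ac)
      also have "\<dots> = \<zeta> t * (1 + t) powr \<nu> * npow (norm x) \<sigma> * z t x powr (p - 1)"
        by (simp add: exp_minus_inverse)
      also have "\<dots> \<le> q t"
        unfolding z_def q_def using Q \<sigma> p k t \<eta> ap
        by (intro potential_moving_weight_decay) (auto simp: \<eta>_def)
      finally show ?thesis .
    qed
  next
    fix x
    \<comment> \<open>At time 0 both integrals vanish, so the datum inherits the weighted bound of
      the solution.\<close>
    have "u0 x = exp 0 * u x 0"
      using s_solution_eq[OF sol _ N, of 0 x] a0 by simp
    also have "\<dots> \<le> A * z 0 x"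
      using order_trans[OF abs_ge_self BC_abs_le_weight[OF B0, of x]]
        mult_right_mono[of "wnorm 1 a (\<lambda>x. exp 0 * u x 0)" A "z 0 x"]
      by (simp add: A_def z_def moving_weight_def)
    finally show "u0 x \<le> w 0 x" by (simp add: w_def g_def)
  qed (use a0 that in auto)
  then have "u x t \<le> A * exp (c * Q / \<eta>) * moving_weight (a / 2) k t x" if "0 \<le> t" for t x
  proof -
    have "exp t * u x t \<le> exp t * (A * (g t * z t x))"
      using \<open>\<And>x t. 0 \<le> t \<Longrightarrow> exp t * u x t \<le> w t x\<close>[OF that, of x] by (simp add: w_def mult_ac)
    then have "u x t \<le> A * (g t * z t x)" by simp
    also have "\<dots> \<le> A * (exp (c * Q / \<eta>) * z t x)"
      using A gG[OF that] z1[OF that, of x] by (intro mult_left_mono mult_right_mono) auto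
    finally show ?thesis by (simp add: z_def mult.assoc)
  qed
  moreover have "0 < A * exp (c * Q / \<eta>)" using A by simp
  ultimately show ?thesis using k by blast
qed

text \<open>For t >= 1 the base 1 + k t + |x|^2 is at most a constant times t (R^2 + |x|^2); the
  power a/2 of this gives the rate.\<close>

lemma weight_ratio_bound:
  fixes x :: "'a::euclidean_space"
  assumes R: "0 < R" and k: "0 \<le> k" and t: "1 \<le> t" and a: "0 \<le> a"
  shows "(R\<^sup>2 + (norm x)\<^sup>2) powr (- a / 2) * moving_weight (a / 2) k t x \<le>
    (1 + (1 + k) / R\<^sup>2) powr (a / 2) * t powr (a / 2)"
proof -
  define r where "r = R\<^sup>2 + (norm x)\<^sup>2"
  have r: "0 < r" using R by (simp add: r_def add_pos_nonneg)
  have "1 + k * t + (norm x)\<^sup>2 \<le> (1 + k) * t + t * (norm x)\<^sup>2"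
    using t mult_right_mono[of 1 t "(norm x)\<^sup>2"] by (simp add: algebra_simps)
  also have "\<dots> \<le> (1 + (1 + k) / R\<^sup>2) * t * r"
  proof -
    have e: "(1 + (1 + k) / R\<^sup>2) * t * r =
        ((1 + k) * t + t * (norm x)\<^sup>2) + (t * R\<^sup>2 + (1 + k) / R\<^sup>2 * t * (norm x)\<^sup>2)"
      using R by (simp add: r_def field_simps)
    have "0 \<le> t * R\<^sup>2 + (1 + k) / R\<^sup>2 * t * (norm x)\<^sup>2"
      using k t by simp
    then show ?thesis unfolding e by simp
  qed
  finally have "moving_weight (a / 2) k t x \<le> ((1 + (1 + k) / R\<^sup>2) * t * r) powr (a / 2)"
    unfolding moving_weight_def using a k t by (intro powr_mono2) (auto intro: add_nonneg_nonneg)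
  also have "\<dots> = (1 + (1 + k) / R\<^sup>2) powr (a / 2) * t powr (a / 2) * r powr (a / 2)"
    using k t r by (simp add: powr_mult add_nonneg_nonneg)
  finally have "r powr (- a / 2) * moving_weight (a / 2) k t x \<le>
      r powr (- a / 2) * ((1 + (1 + k) / R\<^sup>2) powr (a / 2) * t powr (a / 2) * r powr (a / 2))"
    by (intro mult_left_mono) auto
  also have "\<dots> = (1 + (1 + k) / R\<^sup>2) powr (a / 2) * t powr (a / 2)"
    using r by (simp add: powr_minus field_simps)
  finally show ?thesis by (simp add: r_def)
qed

section \<open>The lower estimate\<close>

text \<open>Where the profile is positive, r = |x|^2 / T exceeds \<gamma>, so |x| >= \<rho>, and the
  quartic term forces \<beta> r <= 1. There the profile is at most l (\<gamma> T)^(a/2), hence below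
  l |x|^a; elsewhere nonnegativity of the datum suffices.\<close>

lemma power_profile_le_initial_datum:
  fixes u0 :: "'a::euclidean_space \<Rightarrow> real"
  assumes u0: "\<And>x. \<rho> \<le> norm x \<Longrightarrow> l * norm x powr a \<le> u0 x" "\<And>x. 0 \<le> u0 x"
    and l: "0 < l" and a: "0 < a" and \<gamma>: "0 < \<gamma>" and \<beta>: "0 < \<beta>"
    and T: "0 < T" "\<rho>\<^sup>2 \<le> \<gamma> * T"
  shows "l * \<beta> * \<gamma> powr (a / 2) * T powr (a / 2) *
     ((norm x)\<^sup>2 / T - \<gamma> - \<beta> * (1 + (norm x)\<^sup>2)\<^sup>2 / T\<^sup>2) \<le> u0 x" (is "?c * ?Q \<le> _")
proof (cases "?Q \<le> 0")
  case True
  then have "?c * ?Q \<le> 0"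
    using l \<beta> by (intro mult_nonneg_nonpos) auto
  then show ?thesis using u0(2)[of x] by linarith
next
  case False
  define r where "r = (norm x)\<^sup>2 / T"
  have r0: "0 \<le> r" using T by (simp add: r_def)
  have "0 \<le> \<beta> * (1 + (norm x)\<^sup>2)\<^sup>2 / T\<^sup>2" using \<beta> by simp
  then have r\<gamma>: "\<gamma> < r" and Qr: "?Q \<le> r" using False \<gamma> by (auto simp: r_def)
  have nr: "(norm x)\<^sup>2 = r * T" using T by (simp add: r_def)
  have "\<beta> * r\<^sup>2 = \<beta> * ((norm x)\<^sup>2)\<^sup>2 / T\<^sup>2"
    unfolding r_def power_divide by simp
  also have "\<dots> \<le> \<beta> * (1 + (norm x)\<^sup>2)\<^sup>2 / T\<^sup>2"
    using \<beta> by (intro divide_right_mono mult_left_mono power_mono) auto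
  finally have "\<beta> * r\<^sup>2 < r" using False \<gamma> by (simp add: r_def)
  then have \<beta>r: "\<beta> * r \<le> 1" using r\<gamma> \<gamma> by (simp add: power2_eq_square mult.assoc[symmetric])
  have "\<rho>\<^sup>2 \<le> (norm x)\<^sup>2"
    unfolding nr using T r\<gamma> by (intro order_trans[OF T(2)] mult_right_mono) auto
  then have "\<rho> \<le> norm x" by (rule power2_le_imp_le) simp
  have "?c * ?Q = l * \<gamma> powr (a / 2) * T powr (a / 2) * (\<beta> * ?Q)"
    by (simp only: mult_ac)
  also have "\<dots> \<le> l * \<gamma> powr (a / 2) * T powr (a / 2) * 1"
    using order_trans[OF mult_left_mono[OF Qr, of \<beta>] \<beta>r] \<beta> l by (intro mult_left_mono) auto
  also have "\<dots> \<le> l * (r powr (a / 2) * T powr (a / 2))"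
    using l r\<gamma> \<gamma> a by (auto intro!: mult_right_mono powr_mono2)
  also have "\<dots> = l * ((norm x)\<^sup>2) powr (a / 2)"
    using r0 T by (simp add: nr powr_mult)
  also have "\<dots> = l * norm x powr a"
    using powr_powr[of "norm x" 2 "a / 2"] by simp
  also have "\<dots> \<le> u0 x" by (rule u0) fact
  finally show ?thesis .
qed

text \<open>The product rule in the shape of the lower barrier: A is its static part and F the
  moving weight.\<close>

lemma exp_affine_deriv:
  fixes F :: "real \<Rightarrow> real"
  assumes "(F has_real_derivative F') (at t within S)"
  shows "((\<lambda>t. exp t * d * (A + ((e * t - g) + h * F t))) has_real_derivative
     exp t * d * (A + ((e * t - g) + h * F t)) + exp t * d * (e + h * F')) (at t within S)"
  using assms by (auto intro!: derivative_eq_intros simp: algebra_simps)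

text \<open>Each horizon T gets its own subsolution, evaluated only at x = 0 and t = T; the
  constants do not depend on T.\<close>

lemma s_solution_lower_bound:
  fixes u0 :: "'a::euclidean_space \<Rightarrow> real"
  assumes sol: "s_solution p V a u0 u" and a: "0 < a" and V: "\<And>x t. 0 \<le> t \<Longrightarrow> 0 \<le> V x t"
    and u0: "\<And>x. \<rho> \<le> norm x \<Longrightarrow> l * norm x powr a \<le> u0 x" "\<And>x. 0 \<le> u0 x" and l: "0 < l"
  shows "\<exists>C T0. 0 < C \<and> (\<forall>T\<ge>T0. C * T powr (a / 2) \<le> u 0 T)"
proof -
  \<comment> \<open>The 4 is the growth order of the moving weight with b = 2.\<close>
  obtain N' :: nat where "max a 4 \<le> real N'" using real_arch_simple by blast
  then obtain N :: nat where N: "a \<le> real N" "4 \<le> N" by auto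
  define m where "m = bessel_second_moment TYPE('a)"
  have m: "0 < m" unfolding m_def by (rule bessel_second_moment_pos)
  obtain k where k: "1 \<le> k" and Bk: "\<And>t (x::'a). 0 \<le> t \<Longrightarrow>
      Bop (moving_weight 2 k t) x \<le> moving_weight 2 k t x + 2 * k * moving_weight 1 k t x"
    using Bop_moving_weight_le[of 2, where 'a='a] by auto
  \<comment> \<open>At x = 0, t = T the drift contributes m, while \<gamma> and the quartic term
    cost at most m/4 each. The factor (1 + k)^2 comes from 1 + k T <= (1 + k) T.\<close>
  define \<gamma> where "\<gamma> = m / 4"
  define \<beta> where "\<beta> = m / (4 * (1 + k)\<^sup>2)"
  have \<gamma>: "0 < \<gamma>" and \<beta>: "0 < \<beta>" using m k by (auto simp: \<gamma>_def \<beta>_def)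
  define c where "c = l * \<beta> * \<gamma> powr (a / 2)"
  have c: "0 < c" using l \<beta> \<gamma> by (simp add: c_def)
  have main: "c * m / 2 * T powr (a / 2) \<le> u 0 T" if T1: "1 \<le> T" and T\<rho>: "\<rho>\<^sup>2 / \<gamma> \<le> T" for T
  proof -
    define d where "d = c * T powr (a / 2)"
    have d: "0 < d" using c T1 by (simp add: d_def)
    \<comment> \<open>At t = 0 this is the profile placed below the datum. The drift m t / T matches
      the constant that the operator adds to |x|^2 / T.\<close>
    define P where "P t x = (norm x)\<^sup>2 * (1 / T) + ((m / T * t - \<gamma>) + (- \<beta> / T\<^sup>2) * moving_weight 2 k t x)"
      for t and x :: 'a
    define w where "w t x = exp t * d * P t x" for t x
    define w' where "w' t x = exp t * d * P t x + exp t * d * (m / T + (- \<beta> / T\<^sup>2) * (2 * k * moving_weight 1 k t x))"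
      for t x
    have PG1: "poly_growth N (\<lambda>x::'a. (norm x)\<^sup>2 * (1 / T))"
      using poly_growth_cmult[OF poly_growth_norm2[of N], of "1 / T", where 'a='a] N by simp
    have PG2: "poly_growth N (\<lambda>x::'a. (- \<beta> / T\<^sup>2) * moving_weight 2 k t x)" if "0 \<le> t" for t
      using that N k by (intro poly_growth_cmult poly_growth_moving_weight) auto
    have PG3: "poly_growth N (\<lambda>x::'a. (m / T * t - \<gamma>) + (- \<beta> / T\<^sup>2) * moving_weight 2 k t x)"
      if "0 \<le> t" for t
      by (intro poly_growth_add poly_growth_const PG2 that)
    have "w T 0 \<le> exp T * u 0 T"
    proof (rule s_solution_ge_subsolution[OF sol _ N(1), where w = w and w' = w' and T = T
          and ?M0.0 = "exp T * d * (1 / T + m)"])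
      fix t :: real and x :: 'a assume t: "0 \<le> t"
      show "0 \<le> V x t" by (rule V[OF t])
      show "poly_growth N (w t)"
        unfolding w_def P_def by (intro poly_growth_cmult poly_growth_add PG1 PG3 t)
      show "((\<lambda>t. w t x) has_real_derivative w' t x) (at t within {0..})"
        unfolding w_def w'_def P_def using moving_weight_deriv[of k t 2 x "{0..}"] k t
        by (intro exp_affine_deriv) auto
      have "Bop (P t) x = (norm x)\<^sup>2 / T + m / T + ((m / T * t - \<gamma>) + (- \<beta> / T\<^sup>2) * Bop (moving_weight 2 k t) x)"
        unfolding P_def
        by (subst Bop_add[OF PG1 PG3[OF t]], subst Bop_add[OF poly_growth_const PG2[OF t]])
          (simp only: Bop_cmult Bop_const mult.commute[of _ "1 / T"] Bop_norm2 m_def[symmetric],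
            simp add: add_divide_distrib)
      \<comment> \<open>The moving weight has a negative coefficient, so its upper bound yields a
        lower bound here.\<close>
      also have "\<dots> \<ge> (norm x)\<^sup>2 / T + m / T + ((m / T * t - \<gamma>) +
          (- \<beta> / T\<^sup>2) * (moving_weight 2 k t x + 2 * k * moving_weight 1 k t x))"
        using \<beta> by (intro add_left_mono mult_left_mono_neg Bk t) auto
      finally have "exp t * d * (P t x + (m / T + (- \<beta> / T\<^sup>2) * (2 * k * moving_weight 1 k t x))) \<le>
          exp t * d * Bop (P t) x"
        using d by (intro mult_left_mono) (auto simp: P_def algebra_simps)
      then show "w' t x \<le> Bop (w t) x"
        unfolding w_def[abs_def] w'_def by (simp add: Bop_cmult distrib_left)
    next
      fix t :: real and x :: 'a assume t: "t \<in> {0..T}"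
      have W: "1 \<le> (1 + norm x) ^ N" "(norm x)\<^sup>2 \<le> (1 + norm x) ^ N"
      proof -
        show "1 \<le> (1 + norm x) ^ N" by (simp add: one_le_power)
        have "(norm x)\<^sup>2 \<le> (1 + norm x)\<^sup>2" by (intro power_mono) auto
        also have "\<dots> \<le> (1 + norm x) ^ N" using N by (intro power_increasing) auto
        finally show "(norm x)\<^sup>2 \<le> (1 + norm x) ^ N" .
      qed
      have "P t x \<le> (norm x)\<^sup>2 * (1 / T) + m * 1"
      proof -
        have "m / T * t \<le> m * 1" using t T1 m by (simp add: pos_divide_le_eq)
        moreover have "(- \<beta> / T\<^sup>2) * moving_weight 2 k t x \<le> 0"
          using \<beta> by (intro mult_nonpos_nonneg) auto
        ultimately show ?thesis using \<gamma> by (simp add: P_def)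
      qed
      also have "\<dots> \<le> (1 + norm x) ^ N * (1 / T) + m * (1 + norm x) ^ N"
        using W T1 m by (intro add_mono mult_right_mono mult_left_mono) auto
      also have "\<dots> = (1 / T + m) * (1 + norm x) ^ N" by (simp add: distrib_right)
      finally have "w t x \<le> exp t * d * ((1 / T + m) * (1 + norm x) ^ N)"
        unfolding w_def using d by (intro mult_left_mono) auto
      also have "\<dots> \<le> exp T * d * ((1 / T + m) * (1 + norm x) ^ N)"
        using t d m T1 by (intro mult_right_mono) auto
      finally show "w t x \<le> exp T * d * (1 / T + m) * (1 + norm x) ^ N" by simp
    next
      fix x :: 'a
      have "\<rho>\<^sup>2 \<le> \<gamma> * T" using T\<rho> \<gamma> by (simp add: pos_divide_le_eq mult.commute)
      then have "d * ((norm x)\<^sup>2 / T - \<gamma> - \<beta> * (1 + (norm x)\<^sup>2)\<^sup>2 / T\<^sup>2) \<le> u0 x"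
        unfolding d_def c_def using power_profile_le_initial_datum[OF u0 l a \<gamma> \<beta>, where T = T and x = x] T1 by simp
      then show "w 0 x \<le> u0 x" by (simp add: w_def P_def moving_weight_def algebra_simps)
    qed (use a d m T1 in auto)
    then have "d * P T 0 \<le> u 0 T" by (simp add: w_def mult.assoc)
    moreover have "d * (m / 2) \<le> d * P T 0"
    proof (intro mult_left_mono)
      have "1 + k * T \<le> (1 + k) * T" using T1 by (simp add: distrib_right)
      then have "(1 + k * T)\<^sup>2 \<le> ((1 + k) * T)\<^sup>2" using k T1 by (intro power_mono) auto
      then have "\<beta> * (1 + k * T)\<^sup>2 \<le> \<beta> * ((1 + k) * T)\<^sup>2" using \<beta> by (intro mult_left_mono) auto
      also have "\<dots> = m / 4 * T\<^sup>2" using k by (simp add: \<beta>_def power_mult_distrib)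
      finally have "\<beta> * (1 + k * T)\<^sup>2 / T\<^sup>2 \<le> m / 4" using T1 by (simp add: pos_divide_le_eq)
      then show "m / 2 \<le> P T 0" using T1 k by (simp add: P_def \<gamma>_def moving_weight_def add_nonneg_nonneg)
    qed (use d in auto)
    ultimately show ?thesis by (simp add: d_def mult_ac)
  qed
  show ?thesis
    using main c m by (intro exI[of _ "c * m / 2"] exI[of _ "max 1 (\<rho>\<^sup>2 / \<gamma>)"]) auto
qed

section \<open>From pointwise bounds to the weighted norm\<close>

theorem mainTheorem8:
  fixes p \<nu> \<sigma> a l1 l2 R :: real
    and \<zeta> :: "real \<Rightarrow> real"
    and u0 :: "'a::euclidean_space \<Rightarrow> real"
    and u :: "'a \<Rightarrow> real \<Rightarrow> real"
  assumes p: "0 < p" "p < 1"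
    and \<sigma>: "\<sigma> \<in> Jplus DIM('a)"
    and \<zeta>_cont: "continuous_on {0..} \<zeta>"
    and \<zeta>_pos: "\<forall>t\<ge>0. \<zeta> t > 0"
    and \<zeta>_lim1: "\<forall>\<delta>>0. filterlim (\<lambda>t. t powr \<delta> * \<zeta> t) at_top at_top"
    and \<zeta>_lim2: "\<forall>\<delta>>0. ((\<lambda>t. t powr (-\<delta>) * \<zeta> t) \<longlongrightarrow> 0) at_top"
    and \<zeta>_E: "\<sigma> > 0 \<longrightarrow> (\<exists>\<epsilon>. 0 < \<epsilon> \<and> \<epsilon> < 1 \<and> class_E \<epsilon> (\<lambda>t. \<zeta> t * (1 + t) powr \<nu>))"
    and u0_cont: "continuous_on UNIV u0"
    and u0_nonneg: "\<forall>x. u0 x \<ge> 0"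
    and a: "a > (\<sigma> + 2 * max (\<nu> + 1) 0) / (1 - p)"
    and l: "0 < l1" "0 < l2"
    and liminf: "Liminf at_infinity (\<lambda>x. ereal (norm x powr (-a) * u0 x)) = ereal l1"
    and limsup: "Limsup at_infinity (\<lambda>x. ereal (norm x powr (-a) * u0 x)) = ereal l2"
    and sol: "s_solution p (\<lambda>x t. \<zeta> t * (1 + t) powr \<nu> * npow (norm x) \<sigma>)
                (max (\<sigma> / (1 - p)) a) u0 u"
    and R: "R > 0"
  shows "\<exists>Clo Chi. Clo > 0 \<and> Chi > 0 \<and>
     (\<forall>\<^sub>F t in at_top. Clo * l1 * t powr (a/2) \<le> wnorm R a (\<lambda>x. u x t) \<and>
                       wnorm R a (\<lambda>x. u x t) \<le> Chi * l2 * t powr (a/2))"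
proof -
  have \<sigma>0: "0 \<le> \<sigma>" using \<sigma> by (auto simp: Jplus_def split: if_splits)
  \<comment> \<open>Shows a_0 <= a_c < a, so the growth exponent of the solution class is a
    itself.\<close>
  have "\<sigma> / (1 - p) \<le> (\<sigma> + 2 * max (\<nu> + 1) 0) / (1 - p)"
    using p by (intro divide_right_mono) auto
  moreover have "0 \<le> \<sigma> / (1 - p)" using \<sigma>0 p by simp
  ultimately have a0: "0 < a" and amax: "max (\<sigma> / (1 - p)) a = a" using a by auto
  note sol = sol[unfolded amax]
  have V: "0 \<le> \<zeta> t * (1 + t) powr \<nu> * npow (norm x) \<sigma>" if "0 \<le> t" for x :: 'a and t
    using \<zeta>_pos[rule_format, OF that] by (simp add: npow_nonneg)
  obtain C k where C: "0 < C" and k: "1 \<le> k"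
    and up: "\<And>t x. 0 \<le> t \<Longrightarrow> u x t \<le> C * moving_weight (a / 2) k t x"
    using s_solution_upper_bound[OF p \<sigma>0 \<zeta>_cont \<zeta>_pos[rule_format] \<zeta>_lim2[rule_format] a sol] by auto
  define H where "H = C * (1 + (1 + k) / R\<^sup>2) powr (a / 2)"
  have "0 < 1 + (1 + k) / R\<^sup>2" using k by (intro add_pos_nonneg) auto
  then have H: "0 < H" using C by (simp add: H_def)
  have u_nonneg: "0 \<le> u x t" if "0 \<le> t" for x t
    using sol that by (auto simp: s_solution_def)
  have pt: "(R\<^sup>2 + (norm x)\<^sup>2) powr (- a / 2) * \<bar>u x t\<bar> \<le> H * t powr (a / 2)" if t: "1 \<le> t" for x t
  proof -
    have "(R\<^sup>2 + (norm x)\<^sup>2) powr (- a / 2) * \<bar>u x t\<bar> \<le>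
        (R\<^sup>2 + (norm x)\<^sup>2) powr (- a / 2) * (C * moving_weight (a / 2) k t x)"
      using up[of t x] u_nonneg[of t x] t by (intro mult_left_mono) auto
    also have "\<dots> = C * ((R\<^sup>2 + (norm x)\<^sup>2) powr (- a / 2) * moving_weight (a / 2) k t x)" by simp
    also have "\<dots> \<le> C * ((1 + (1 + k) / R\<^sup>2) powr (a / 2) * t powr (a / 2))"
      using C k a0 by (intro mult_left_mono weight_ratio_bound R t) auto
    finally show ?thesis by (simp add: H_def mult.assoc)
  qed
  have upper: "wnorm R a (\<lambda>x. u x t) \<le> H * t powr (a / 2)" if "1 \<le> t" for t
    unfolding wnorm_def using pt[OF that] by (intro cSUP_least) auto
  \<comment> \<open>The supremum dominates the value at the origin; \<open>pt\<close> supplies the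
    boundedness without which the real supremum gives no information.\<close>
  have lower: "R powr (- a) * u 0 t \<le> wnorm R a (\<lambda>x. u x t)" if t: "1 \<le> t" for t
  proof -
    have "bdd_above (range (\<lambda>x. (R\<^sup>2 + (norm x)\<^sup>2) powr (- a / 2) * \<bar>u x t\<bar>))"
      using pt[OF t] by (intro bdd_aboveI2)
    then have "(R\<^sup>2 + (norm (0::'a))\<^sup>2) powr (- a / 2) * \<bar>u 0 t\<bar> \<le> wnorm R a (\<lambda>x. u x t)"
      unfolding wnorm_def by (rule cSUP_upper[OF UNIV_I])
    moreover have "(R\<^sup>2) powr (- a / 2) = R powr (- a)"
      using R powr_powr[of R 2 "- a / 2"] by simp
    ultimately show ?thesis using u_nonneg[of t 0] t by simp
  qed
  \<comment> \<open>The lower limit guarantees only constants strictly below l1 near infinity; half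
    of it is taken.\<close>
  have "ereal (l1 / 2) < Liminf at_infinity (\<lambda>x. ereal (norm x powr (-a) * u0 x))"
    unfolding liminf using l by simp
  from less_LiminfD[OF this] obtain \<rho> where \<rho>: "\<And>x. \<rho> \<le> norm x \<Longrightarrow> l1 / 2 < norm x powr (-a) * u0 x"
    by (auto simp: eventually_at_infinity)
  have u0_low: "l1 / 2 * norm x powr a \<le> u0 x" if "\<rho> \<le> norm x" for x
  proof (cases "x = 0")
    case False
    have "norm x powr a * (l1 / 2) \<le> norm x powr a * (norm x powr (-a) * u0 x)"
      using \<rho>[OF that] by (intro mult_left_mono) auto
    also have "\<dots> = u0 x" using False by (simp add: powr_minus)
    finally show ?thesis by (simp add: mult.commute)
  qed (use u0_nonneg in auto)
  obtain D T0 where D: "0 < D" and low: "\<And>T. T0 \<le> T \<Longrightarrow> D * T powr (a / 2) \<le> u 0 T"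
    using s_solution_lower_bound[OF sol a0 V, where \<rho> = \<rho> and l = "l1 / 2"] u0_low u0_nonneg l by auto
  show ?thesis
  \<comment> \<open>Division by l1 and l2 brings the two estimates into the required form.\<close>
  proof (rule exI[of _ "R powr (- a) * D / l1"], rule exI[of _ "H / l2"], intro conjI)
    show "\<forall>\<^sub>F t in at_top. R powr (- a) * D / l1 * l1 * t powr (a/2) \<le> wnorm R a (\<lambda>x. u x t) \<and>
        wnorm R a (\<lambda>x. u x t) \<le> H / l2 * l2 * t powr (a/2)"
      using eventually_ge_at_top[of "max 1 T0"]
    proof eventually_elim
      case (elim t)
      have "R powr (- a) * (D * t powr (a / 2)) \<le> R powr (- a) * u 0 t"
        using elim by (intro mult_left_mono low) auto
      then show ?case
        using lower[of t] upper[of t] elim l by (simp add: mult.assoc)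
    qed
  qed (use D H R l in auto)
qed

end
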